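(* Let $(G,w,a)$ be an infinite, locally finite, connected, oriented, weighted graph. Let $\sigma\colon E_0\to U(1)$ satisfy $\sigma(\widehat e)=\overline{\sigma(e)}$ for all $e\in E_0$, let $q\colon V\to\mathbb{R}$, and let $H=\Delta_\sigma+q$. Fix a vertex $x_0\in V$ and assume that $$\lim_{n\to\infty}\frac{m_n a_n}{n^2}=0,$$ where $$m_n:=\max_{x\in V,\ r(x)\le n} m(x),\qquad a_n:=\max_{x\in V,\ r(x)\le n}\ \max_{e\sim x}\frac{a(e)}{w(x)}.$$ Additionally, assume that there exists a constant $C\in\mathbb{R}$ such that $$(Hu,u)\ge -C\|u\|^2\qquad\text{for all }u\in C_c(V).$$ Then the operator $H|_{C_c(V)}$ is essentially self-adjoint in $\ell^2_w(V)$.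
   Context: $G=(V,E)$ is a graph with vertex set $V$ and set of unoriented edges $E$, without loops and without multiple edges between vertices. $m(x)$ denotes the degree of the vertex $x$ (number of edges meeting at $x$); locally finite means $m(x)<\infty$ for every $x$. $x\sim y$ means there is an edge connecting $x$ and $y$. Connected means any two vertices are joined by a finite path $x_1,\dots,x_n$ with $x_j\sim x_{j+1}$. The distance $d(x,y)$ is the number of edges in a shortest path connecting $x$ and $y$, and $r(x):=d(x_0,x)$. Oriented edges: $E_0=\{[x,y],[y,x]: x,y\in V,\ x\sim y\}$; for $e=[x,y]$, $o(e)=x$ is the starting vertex, $t(e)=y$ the terminal vertex, and $\widehat e=[y,x]$ the reverse edge. An orientation is fixed by a choice of subset $E_s\subset E_0$ with $E_0=E_s\cup\widehat{E_s}$ (disjoint union), where $\widehat{E_s}=\{\widehat e: e\in E_s\}$ ("oriented graph" means that such a choice has been made). For $e\in E_s$ and $x\in V$, $e\sim x$ means $t(e)=x$ or $o(e)=x$. For $x\in V$, $\mathcal{O}_x=\{e\in E_0: o(e)=x\}$. Weights: $w\colon V\to\mathbb{R}^+=(0,\infty)$ and $a\colon E_0\to\mathbb{R}^+$ with $a(e)=a(\widehat e)$ for all $e\in E_0$. $U(1)=\{z\in\mathbb{C}:|z|=1\}$. $C(V)$ is the space of complex-valued functions on $V$ and $C_c(V)$ its subspace of finitely supported functions. $\ell^2_w(V)$ is the Hilbert space of $f\in C(V)$ with $\|f\|<\infty$, with inner product $(f,g)=\sum_{x\in V}w(x)f(x)\overline{g(x)}$ and corresponding norm $\|\cdot\|$.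 The magnetic Laplacian $\Delta_\sigma\colon C(V)\to C(V)$ is $$(\Delta_\sigma u)(x)=\frac{1}{w(x)}\sum_{e\in\mathcal{O}_x}a(e)\bigl(u(x)-\sigma(\widehat e)u(t(e))\bigr),$$ and $Hu=\Delta_\sigma u+qu$. *)

theory Defs
  imports "HOL-Analysis.Analysis"
begin

section \<open>Graphs\<close>

text \<open>
  A graph has a vertex set \<open>V\<close> and a set \<open>E\<close> of unoriented edges, which are two-element subsets
  of \<open>V\<close>; this rules out loops and multiple edges.  An oriented edge is a pair \<open>(x, y)\<close>, so that
  \<open>fst\<close>, \<open>snd\<close> and \<open>prod.swap\<close> are the starting vertex, the terminal vertex and the reversal.
\<close>

definition simple_graph :: "'v set \<Rightarrow> 'v set set \<Rightarrow> bool" where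
  "simple_graph V E \<longleftrightarrow> (\<forall>e\<in>E. e \<subseteq> V \<and> card e = 2)"

definition oriented_edges :: "'v set set \<Rightarrow> ('v \<times> 'v) set" where
  "oriented_edges E = {(x, y). {x, y} \<in> E \<and> x \<noteq> y}"

definition degree :: "'v set set \<Rightarrow> 'v \<Rightarrow> nat" where
  "degree E x = card {e \<in> E. x \<in> e}"

definition locally_finite :: "'v set \<Rightarrow> 'v set set \<Rightarrow> bool" where
  "locally_finite V E \<longleftrightarrow> (\<forall>x\<in>V. finite {e \<in> E. x \<in> e})"

definition connected_graph :: "'v set \<Rightarrow> 'v set set \<Rightarrow> bool" where
  "connected_graph V E \<longleftrightarrow> (\<forall>x\<in>V. \<forall>y\<in>V. (x, y) \<in> (oriented_edges E)\<^sup>*)"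

text \<open>The \<open>n\<close>-th relational power of the adjacency relation relates the endpoints of the paths
  with \<open>n\<close> edges.\<close>

definition graph_dist :: "'v set set \<Rightarrow> 'v \<Rightarrow> 'v \<Rightarrow> nat" where
  "graph_dist E x y = (LEAST n. (x, y) \<in> oriented_edges E ^^ n)"

definition is_orientation :: "'v set set \<Rightarrow> ('v \<times> 'v) set \<Rightarrow> bool" where
  "is_orientation E Es \<longleftrightarrow>
     oriented_edges E = Es \<union> prod.swap ` Es \<and> Es \<inter> prod.swap ` Es = {}"

definition incident :: "'v \<times> 'v \<Rightarrow> 'v \<Rightarrow> bool" where
  "incident e x \<longleftrightarrow> snd e = x \<or> fst e = x"

definition out_edges :: "'v set set \<Rightarrow> 'v \<Rightarrow> ('v \<times> 'v) set" where
  "out_edges E x = {e \<in> oriented_edges E. fst e = x}"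

definition graph_weights ::
  "'v set \<Rightarrow> 'v set set \<Rightarrow> ('v \<Rightarrow> real) \<Rightarrow> ('v \<times> 'v \<Rightarrow> real) \<Rightarrow> bool" where
  "graph_weights V E w a \<longleftrightarrow>
     (\<forall>x\<in>V. w x > 0) \<and> (\<forall>e\<in>oriented_edges E. a e > 0 \<and> a (prod.swap e) = a e)"

definition magnetic_phase :: "'v set set \<Rightarrow> ('v \<times> 'v \<Rightarrow> complex) \<Rightarrow> bool" where
  "magnetic_phase E \<sigma> \<longleftrightarrow>
     (\<forall>e\<in>oriented_edges E. cmod (\<sigma> e) = 1 \<and> \<sigma> (prod.swap e) = cnj (\<sigma> e))"

definition graph_ball :: "'v set \<Rightarrow> 'v set set \<Rightarrow> 'v \<Rightarrow> nat \<Rightarrow> 'v set" where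
  "graph_ball V E x0 n = {x \<in> V. graph_dist E x0 x \<le> n}"

text \<open>All sets to which \<open>Max\<close> is applied below are finite and nonempty when the graph is infinite,
  locally finite and connected, and \<open>x0 \<in> V\<close>.\<close>

definition max_degree :: "'v set \<Rightarrow> 'v set set \<Rightarrow> 'v \<Rightarrow> nat \<Rightarrow> nat" where
  "max_degree V E x0 n = Max (degree E ` graph_ball V E x0 n)"

definition max_weight_ratio ::
  "'v set \<Rightarrow> 'v set set \<Rightarrow> ('v \<times> 'v) set \<Rightarrow> ('v \<Rightarrow> real) \<Rightarrow> ('v \<times> 'v \<Rightarrow> real) \<Rightarrow> 'v \<Rightarrow> nat \<Rightarrow> real"
  where
  "max_weight_ratio V E Es w a x0 n =
     Max ((\<lambda>x. Max ((\<lambda>e. a e / w x) ` {e \<in> Es. incident e x})) ` graph_ball V E x0 n)"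

section \<open>Function spaces\<close>

text \<open>Functions on \<open>V\<close> are represented by functions on the whole type that vanish outside \<open>V\<close>.\<close>

definition fun_space :: "'v set \<Rightarrow> ('v \<Rightarrow> complex) set" where
  "fun_space V = {f. \<forall>x. x \<notin> V \<longrightarrow> f x = 0}"

definition fin_supp_space :: "'v set \<Rightarrow> ('v \<Rightarrow> complex) set" where
  "fin_supp_space V = {f \<in> fun_space V. finite {x. f x \<noteq> 0}}"

definition l2_space :: "'v set \<Rightarrow> ('v \<Rightarrow> real) \<Rightarrow> ('v \<Rightarrow> complex) set" where
  "l2_space V w = {f \<in> fun_space V. (\<lambda>x. w x * (cmod (f x))\<^sup>2) summable_on V}"

definition l2_inner ::
  "'v set \<Rightarrow> ('v \<Rightarrow> real) \<Rightarrow> ('v \<Rightarrow> complex) \<Rightarrow> ('v \<Rightarrow> complex) \<Rightarrow> complex" where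
  "l2_inner V w f g = (\<Sum>\<^sub>\<infinity>x\<in>V. of_real (w x) * f x * cnj (g x))"

definition l2_norm :: "'v set \<Rightarrow> ('v \<Rightarrow> real) \<Rightarrow> ('v \<Rightarrow> complex) \<Rightarrow> real" where
  "l2_norm V w f = sqrt (Re (l2_inner V w f f))"

section \<open>Unbounded operators in the weighted \<open>\<ell>\<^sup>2\<close>-space\<close>

text \<open>An operator is identified with its graph, so that its domain is \<open>Domain T\<close>.\<close>

type_synonym 'v operator = "(('v \<Rightarrow> complex) \<times> ('v \<Rightarrow> complex)) set"

definition linear_operator :: "'v set \<Rightarrow> ('v \<Rightarrow> real) \<Rightarrow> 'v operator \<Rightarrow> bool" where
  "linear_operator V w T \<longleftrightarrow>
     T \<subseteq> l2_space V w \<times> l2_space V w \<and> single_valued T \<and>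
     (\<lambda>x. 0, \<lambda>x. 0) \<in> T \<and>
     (\<forall>(f, g)\<in>T. \<forall>(f', g')\<in>T. (\<lambda>x. f x + f' x, \<lambda>x. g x + g' x) \<in> T) \<and>
     (\<forall>c. \<forall>(f, g)\<in>T. (\<lambda>x. c * f x, \<lambda>x. c * g x) \<in> T)"

definition densely_defined :: "'v set \<Rightarrow> ('v \<Rightarrow> real) \<Rightarrow> 'v operator \<Rightarrow> bool" where
  "densely_defined V w T \<longleftrightarrow>
     (\<forall>f\<in>l2_space V w. \<forall>\<epsilon>>0. \<exists>u\<in>Domain T. l2_norm V w (\<lambda>x. f x - u x) < \<epsilon>)"

definition operator_closure :: "'v set \<Rightarrow> ('v \<Rightarrow> real) \<Rightarrow> 'v operator \<Rightarrow> 'v operator" where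
  "operator_closure V w T =
     {(f, g) \<in> l2_space V w \<times> l2_space V w.
        \<forall>\<epsilon>>0. \<exists>(u, v)\<in>T. l2_norm V w (\<lambda>x. f x - u x) < \<epsilon> \<and> l2_norm V w (\<lambda>x. g x - v x) < \<epsilon>}"

definition adjoint_operator :: "'v set \<Rightarrow> ('v \<Rightarrow> real) \<Rightarrow> 'v operator \<Rightarrow> 'v operator" where
  "adjoint_operator V w T =
     {(f, g) \<in> l2_space V w \<times> l2_space V w.
        \<forall>(u, v)\<in>T. l2_inner V w v f = l2_inner V w u g}"

definition symmetric_operator :: "'v set \<Rightarrow> ('v \<Rightarrow> real) \<Rightarrow> 'v operator \<Rightarrow> bool" where
  "symmetric_operator V w T \<longleftrightarrow>
     linear_operator V w T \<and> densely_defined V w T \<and> T \<subseteq> adjoint_operator V w T"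

definition self_adjoint :: "'v set \<Rightarrow> ('v \<Rightarrow> real) \<Rightarrow> 'v operator \<Rightarrow> bool" where
  "self_adjoint V w T \<longleftrightarrow>
     linear_operator V w T \<and> densely_defined V w T \<and> adjoint_operator V w T = T"

definition essentially_self_adjoint :: "'v set \<Rightarrow> ('v \<Rightarrow> real) \<Rightarrow> 'v operator \<Rightarrow> bool" where
  "essentially_self_adjoint V w T \<longleftrightarrow>
     symmetric_operator V w T \<and> self_adjoint V w (operator_closure V w T)"

section \<open>The magnetic Schroedinger operator\<close>

definition magnetic_laplacian ::
  "'v set \<Rightarrow> 'v set set \<Rightarrow> ('v \<Rightarrow> real) \<Rightarrow> ('v \<times> 'v \<Rightarrow> real) \<Rightarrow> ('v \<times> 'v \<Rightarrow> complex) \<Rightarrow>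
     ('v \<Rightarrow> complex) \<Rightarrow> 'v \<Rightarrow> complex" where
  "magnetic_laplacian V E w a \<sigma> u x =
     (if x \<in> V
      then 1 / of_real (w x) *
        (\<Sum>e\<in>out_edges E x. of_real (a e) * (u x - \<sigma> (prod.swap e) * u (snd e)))
      else 0)"

definition magnetic_schroedinger ::
  "'v set \<Rightarrow> 'v set set \<Rightarrow> ('v \<Rightarrow> real) \<Rightarrow> ('v \<times> 'v \<Rightarrow> real) \<Rightarrow> ('v \<times> 'v \<Rightarrow> complex) \<Rightarrow>
     ('v \<Rightarrow> real) \<Rightarrow> ('v \<Rightarrow> complex) \<Rightarrow> 'v \<Rightarrow> complex" where
  "magnetic_schroedinger V E w a \<sigma> q u x =
     magnetic_laplacian V E w a \<sigma> u x + of_real (q x) * u x"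

definition operator_on ::
  "(('v \<Rightarrow> complex) \<Rightarrow> 'v \<Rightarrow> complex) \<Rightarrow> ('v \<Rightarrow> complex) set \<Rightarrow> 'v operator" where
  "operator_on A D = {(u, A u) | u. u \<in> D}"

end

theory Submission
  imports Defs
begin

text \<open>
  Essential self-adjointness of the semibounded operator \<open>H\<close> on the finitely supported functions
  reduces to the absence of square summable solutions of \<open>H f = - \<mu> f\<close> for one \<open>\<mu> > C\<close>: then the
  range of \<open>H + \<mu>\<close> is dense, and since \<open>\<parallel>u\<parallel> \<le> \<parallel>(H + \<mu>) u\<parallel>\<close> every element of the domain of the
  adjoint is approximated in the graph norm.  For such a solution \<open>f\<close> and a finitely supported real
  cutoff \<open>\<eta>\<close>, the form of \<open>\<eta> f\<close> equals \<open>- \<mu> \<parallel>\<eta> f\<parallel>\<^sup>2\<close> up to an error bounded by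
  \<open>\<Sum>\<^sub>x |f x|\<^sup>2 \<Sum>\<^sub>y a (x, y) (\<eta> x - \<eta> y)\<^sup>2 / 2\<close>.  With the cone \<open>\<eta> = max 0 (1 - r / n)\<close> this
  error is at most \<open>m\<^sub>n a\<^sub>n \<parallel>f\<parallel>\<^sup>2 / (2 n\<^sup>2)\<close>, so semiboundedness gives \<open>f = 0\<close> in the limit.
\<close>

section \<open>The weighted sequence space\<close>

locale weighted_l2 =
  fixes V :: "'v set" and w :: "'v \<Rightarrow> real"
  assumes weight_pos: "x \<in> V \<Longrightarrow> w x > 0"
begin

section \<open>Summability and the norm\<close>

lemma l2_spaceD:
  assumes "f \<in> l2_space V w"
  shows "(\<lambda>x. w x * (cmod (f x))\<^sup>2) summable_on V" and "x \<notin> V \<Longrightarrow> f x = 0"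
  using assms by (auto simp: l2_space_def fun_space_def)

lemma fin_supp_spaceD:
  assumes "u \<in> fin_supp_space V"
  shows "finite {x. u x \<noteq> 0}" "{x. u x \<noteq> 0} \<subseteq> V"
  using assms by (auto simp: fin_supp_space_def fun_space_def)

lemma fin_supp_in_l2:
  assumes "u \<in> fin_supp_space V"
  shows "u \<in> l2_space V w"
proof -
  have "(\<lambda>x. w x * (cmod (u x))\<^sup>2) summable_on V"
    by (rule finite_nonzero_values_imp_summable_on)
      (auto intro: finite_subset[OF _ fin_supp_spaceD(1)[OF assms]])
  with assms show ?thesis
    by (simp add: l2_space_def fin_supp_space_def)
qed

text \<open>Absolute convergence follows from 2 |f g| \<le> |f|^2 + |g|^2 pointwise. As
  \<open>infsum\<close> of a divergent family is 0, summability is what licenses additivity of the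
  inner product.\<close>

lemma summable_l2_inner:
  assumes "f \<in> l2_space V w" "g \<in> l2_space V w"
  shows "(\<lambda>x. of_real (w x) * f x * cnj (g x)) summable_on V"
proof -
  have "(\<lambda>x. norm (of_real (w x) * f x * cnj (g x))) summable_on V"
  proof (rule Infinite_Sum.abs_summable_on_comparison_test')
    show "(\<lambda>x. w x * (cmod (f x))\<^sup>2 + w x * (cmod (g x))\<^sup>2) summable_on V"
      by (intro summable_on_add l2_spaceD(1) assms)
    fix x assume "x \<in> V"
    then have "w x > 0" by (rule weight_pos)
    have "2 * (cmod (f x) * cmod (g x)) \<le> (cmod (f x))\<^sup>2 + (cmod (g x))\<^sup>2"
      using sum_squares_bound[of "cmod (f x)" "cmod (g x)"] by (simp add: mult.assoc)
    then have "cmod (f x) * cmod (g x) \<le> (cmod (f x))\<^sup>2 + (cmod (g x))\<^sup>2"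
      using mult_nonneg_nonneg[OF norm_ge_zero[of "f x"] norm_ge_zero[of "g x"]] by linarith
    then have "w x * (cmod (f x) * cmod (g x)) \<le> w x * ((cmod (f x))\<^sup>2 + (cmod (g x))\<^sup>2)"
      using \<open>w x > 0\<close> by (intro mult_left_mono) auto
    then show "norm (of_real (w x) * f x * cnj (g x)) \<le> w x * (cmod (f x))\<^sup>2 + w x * (cmod (g x))\<^sup>2"
      using \<open>w x > 0\<close> by (simp add: norm_mult algebra_simps)
  qed
  then show ?thesis by (rule abs_summable_summable)
qed

text \<open>Holds for every function: if the real family is not summable, neither is its complex
  copy, and both sums take the default value 0.\<close>

lemma l2_inner_self: "l2_inner V w f f = of_real (\<Sum>\<^sub>\<infinity>x\<in>V. w x * (cmod (f x))\<^sup>2)"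
proof -
  let ?p = "\<lambda>x. w x * (cmod (f x))\<^sup>2"
  have "l2_inner V w f f = (\<Sum>\<^sub>\<infinity>x\<in>V. of_real (?p x))"
    unfolding l2_inner_def by (intro infsum_cong) (simp add: complex_norm_square[symmetric] mult.assoc)
  also have "\<dots> = of_real (infsum ?p V)"
  proof (cases "?p summable_on V")
    case True
    then show ?thesis by (intro infsumI) (simp only: has_sum_of_real_iff has_sum_infsum)
  next
    case False
    then have not_summable: "\<not> (\<lambda>x. of_real (?p x) :: complex) summable_on V"
      using summable_on_Re[of "\<lambda>x. of_real (?p x)" V] by (auto simp only: Re_complex_of_real)
    show ?thesis
      unfolding infsum_not_exists[OF False] infsum_not_exists[OF not_summable] by simp
  qed
  finally show ?thesis .
qed

lemma l2_norm_sq: "(l2_norm V w f)\<^sup>2 = (\<Sum>\<^sub>\<infinity>x\<in>V. w x * (cmod (f x))\<^sup>2)"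
proof -
  have "(\<Sum>\<^sub>\<infinity>x\<in>V. w x * (cmod (f x))\<^sup>2) \<ge> 0"
    by (intro infsum_nonneg) (simp add: less_imp_le[OF weight_pos])
  then show ?thesis by (simp add: l2_norm_def l2_inner_self)
qed

lemma l2_inner_self_norm: "l2_inner V w f f = of_real ((l2_norm V w f)\<^sup>2)"
  by (simp add: l2_inner_self l2_norm_sq)

lemma l2_norm_nonneg [simp]: "l2_norm V w f \<ge> 0"
proof -
  have "Re (l2_inner V w f f) \<ge> 0" by (simp add: l2_inner_self_norm del: of_real_power)
  then show ?thesis by (simp add: l2_norm_def)
qed

lemma finite_sum_le_l2_norm_sq:
  assumes "f \<in> l2_space V w" "finite F" "F \<subseteq> V"
  shows "(\<Sum>x\<in>F. w x * (cmod (f x))\<^sup>2) \<le> (l2_norm V w f)\<^sup>2"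
  unfolding l2_norm_sq using assms
  by (intro finite_sum_le_infsum l2_spaceD(1)) (auto intro!: mult_nonneg_nonneg less_imp_le[OF weight_pos])

lemma point_le_l2_norm_sq:
  assumes "f \<in> l2_space V w" "x \<in> V"
  shows "w x * (cmod (f x))\<^sup>2 \<le> (l2_norm V w f)\<^sup>2"
  using finite_sum_le_l2_norm_sq[of f "{x}"] assms by simp

lemma l2_norm_eq_0:
  assumes "f \<in> l2_space V w" "l2_norm V w f = 0"
  shows "f = (\<lambda>x. 0)"
proof
  fix x show "f x = 0"
  proof (cases "x \<in> V")
    case True
    then have "w x * (cmod (f x))\<^sup>2 \<le> 0"
      using point_le_l2_norm_sq[OF assms(1) True] assms(2) by simp
    then show ?thesis using weight_pos[OF True] by (simp add: mult_le_0_iff)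
  qed (use l2_spaceD(2)[OF assms(1)] in auto)
qed

text \<open>The terms are nonnegative, so a uniform bound on finite partial sums yields membership
  and the norm bound together; this suits functions known only as pointwise limits.\<close>

lemma l2_bounded_sums:
  assumes "\<And>x. x \<notin> V \<Longrightarrow> f x = 0"
    and "\<And>F. finite F \<Longrightarrow> F \<subseteq> V \<Longrightarrow> (\<Sum>x\<in>F. w x * (cmod (f x))\<^sup>2) \<le> B\<^sup>2" and "B \<ge> 0"
  shows "f \<in> l2_space V w" "l2_norm V w f \<le> B"
proof -
  have *: "(\<lambda>x. w x * (cmod (f x))\<^sup>2) summable_on V"
    by (rule nonneg_bdd_above_summable_on)
      (auto intro!: bdd_aboveI2[where M = "B\<^sup>2"] assms mult_nonneg_nonneg less_imp_le[OF weight_pos])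
  then show "f \<in> l2_space V w" using assms(1) by (simp add: l2_space_def fun_space_def)
  have "(l2_norm V w f)\<^sup>2 \<le> B\<^sup>2"
    unfolding l2_norm_sq using * assms(2) by (rule infsum_le_finite_sums)
  then show "l2_norm V w f \<le> B" using assms(3) by (rule power2_le_imp_le)
qed

section \<open>Linear structure and the inner product\<close>

lemma l2_zero: "(\<lambda>x. 0) \<in> l2_space V w"
  by (simp add: l2_space_def fun_space_def)

lemma l2_scale:
  assumes "f \<in> l2_space V w"
  shows "(\<lambda>x. c * f x) \<in> l2_space V w"
proof -
  have "(\<lambda>x. (cmod c)\<^sup>2 * (w x * (cmod (f x))\<^sup>2)) summable_on V"
    by (intro summable_on_cmult_right l2_spaceD(1) assms)
  then show ?thesis using l2_spaceD(2)[OF assms]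
    by (simp add: l2_space_def fun_space_def norm_mult power_mult_distrib mult.left_commute)
qed

lemma l2_add:
  assumes "f \<in> l2_space V w" "g \<in> l2_space V w"
  shows "(\<lambda>x. f x + g x) \<in> l2_space V w"
proof -
  have "(\<lambda>x. w x * (cmod (f x + g x))\<^sup>2) summable_on V"
  proof (rule summable_on_comparison_test)
    show "(\<lambda>x. 2 * (w x * (cmod (f x))\<^sup>2) + 2 * (w x * (cmod (g x))\<^sup>2)) summable_on V"
      by (intro summable_on_add summable_on_cmult_right l2_spaceD(1) assms)
    fix x assume x: "x \<in> V"
    have "(cmod (f x + g x))\<^sup>2 \<le> (cmod (f x) + cmod (g x))\<^sup>2"
      by (intro power_mono norm_triangle_ineq) auto
    also have "\<dots> \<le> 2 * (cmod (f x))\<^sup>2 + 2 * (cmod (g x))\<^sup>2"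
      using sum_squares_bound[of "cmod (f x)" "cmod (g x)"] by (simp add: power2_sum)
    finally show "w x * (cmod (f x + g x))\<^sup>2 \<le> 2 * (w x * (cmod (f x))\<^sup>2) + 2 * (w x * (cmod (g x))\<^sup>2)"
      using mult_left_mono[of _ _ "w x"] weight_pos[OF x] by (fastforce simp: algebra_simps)
    show "0 \<le> w x * (cmod (f x + g x))\<^sup>2" using weight_pos[OF x] by simp
  qed
  then show ?thesis using l2_spaceD(2) assms
    by (simp add: l2_space_def fun_space_def)
qed

lemma l2_diff:
  assumes "f \<in> l2_space V w" "g \<in> l2_space V w"
  shows "(\<lambda>x. f x - g x) \<in> l2_space V w"
  using l2_add[OF assms(1) l2_scale[OF assms(2), of "-1"]] by simp

lemma l2_inner_cnj: "l2_inner V w g f = cnj (l2_inner V w f g)"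
  unfolding l2_inner_def infsum_cnj[symmetric] by (intro infsum_cong) (simp add: mult_ac)

lemma l2_inner_scale_left: "l2_inner V w (\<lambda>x. c * f x) g = c * l2_inner V w f g"
  unfolding l2_inner_def infsum_cmult_right'[symmetric] by (intro infsum_cong) (simp add: mult_ac)

lemma l2_inner_scale_right: "l2_inner V w f (\<lambda>x. c * g x) = cnj c * l2_inner V w f g"
  using l2_inner_cnj[of f "\<lambda>x. c * g x"] l2_inner_scale_left[of c g f] l2_inner_cnj[of f g]
  by (metis complex_cnj_mult l2_inner_cnj)

lemma l2_inner_add_left:
  assumes "f \<in> l2_space V w" "g \<in> l2_space V w" "h \<in> l2_space V w"
  shows "l2_inner V w (\<lambda>x. f x + g x) h = l2_inner V w f h + l2_inner V w g h"
  unfolding l2_inner_def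
  by (subst infsum_add[symmetric, OF summable_l2_inner summable_l2_inner])
    (auto simp: assms algebra_simps)

lemma l2_inner_diff_left:
  assumes "f \<in> l2_space V w" "g \<in> l2_space V w" "h \<in> l2_space V w"
  shows "l2_inner V w (\<lambda>x. f x - g x) h = l2_inner V w f h - l2_inner V w g h"
  using l2_inner_add_left[OF assms(1) l2_scale[OF assms(2), of "-1"] assms(3)]
    l2_inner_scale_left[of "-1" g h] by simp

lemma l2_inner_add_right:
  assumes "f \<in> l2_space V w" "g \<in> l2_space V w" "h \<in> l2_space V w"
  shows "l2_inner V w h (\<lambda>x. f x + g x) = l2_inner V w h f + l2_inner V w h g"
  using arg_cong[OF l2_inner_add_left[OF assms], of cnj] by (simp flip: l2_inner_cnj)

lemma l2_norm_sq_add: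
  assumes "f \<in> l2_space V w" "g \<in> l2_space V w"
  shows "(l2_norm V w (\<lambda>x. f x + g x))\<^sup>2
    = (l2_norm V w f)\<^sup>2 + 2 * Re (l2_inner V w f g) + (l2_norm V w g)\<^sup>2"
proof -
  have "of_real ((l2_norm V w (\<lambda>x. f x + g x))\<^sup>2) = l2_inner V w f f + l2_inner V w f g
      + cnj (l2_inner V w f g) + l2_inner V w g g"
    unfolding l2_inner_self_norm[symmetric]
    by (simp add: l2_inner_add_left l2_inner_add_right l2_add assms flip: l2_inner_cnj)
  then have "Re (of_real ((l2_norm V w (\<lambda>x. f x + g x))\<^sup>2)) = Re (l2_inner V w f f + l2_inner V w f g
      + cnj (l2_inner V w f g) + l2_inner V w g g)" by (rule arg_cong)
  then show ?thesis by (simp add: l2_inner_self_norm del: of_real_power)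
qed

lemma l2_norm_scale: "l2_norm V w (\<lambda>x. c * f x) = cmod c * l2_norm V w f"
proof (rule power2_eq_imp_eq)
  have "(l2_norm V w (\<lambda>x. c * f x))\<^sup>2 = (\<Sum>\<^sub>\<infinity>x\<in>V. (cmod c)\<^sup>2 * (w x * (cmod (f x))\<^sup>2))"
    unfolding l2_norm_sq by (intro infsum_cong) (simp add: norm_mult power_mult_distrib)
  also have "\<dots> = (cmod c)\<^sup>2 * (l2_norm V w f)\<^sup>2"
    unfolding l2_norm_sq by (rule infsum_cmult_right')
  finally show "(l2_norm V w (\<lambda>x. c * f x))\<^sup>2 = (cmod c * l2_norm V w f)\<^sup>2"
    by (simp add: power_mult_distrib)
qed auto

lemma l2_norm_minus_commute: "l2_norm V w (\<lambda>x. f x - g x) = l2_norm V w (\<lambda>x. g x - f x)"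
  using l2_norm_scale[of "-1" "\<lambda>x. g x - f x"] by simp

lemma l2_norm_sq_diff_scale:
  assumes "f \<in> l2_space V w" "g \<in> l2_space V w"
  shows "(l2_norm V w (\<lambda>x. f x - c * g x))\<^sup>2
    = (l2_norm V w f)\<^sup>2 - 2 * Re (cnj c * l2_inner V w f g) + (cmod c)\<^sup>2 * (l2_norm V w g)\<^sup>2"
  using l2_norm_sq_add[OF assms(1) l2_scale[OF assms(2), of "-c"]]
    l2_inner_scale_right[of f "-c" g] l2_norm_scale[of "-c" g]
  by (simp add: power_mult_distrib)

text \<open>The squared norm of \<open>f - c * g\<close> is nonnegative; taking for \<open>c\<close>
  the coefficient of the projection of \<open>f\<close> onto \<open>g\<close> gives the
  bound.\<close>

lemma l2_Cauchy_Schwarz: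
  assumes "f \<in> l2_space V w" "g \<in> l2_space V w"
  shows "cmod (l2_inner V w f g) \<le> l2_norm V w f * l2_norm V w g"
proof (cases "l2_norm V w g = 0")
  case True
  then have "g = (\<lambda>x. 0)" using l2_norm_eq_0 assms by blast
  then show ?thesis by (simp add: l2_inner_def True)
next
  case False
  define N c where "N = (l2_norm V w g)\<^sup>2" and "c = l2_inner V w f g / of_real N"
  have "N > 0" using False by (simp add: N_def)
  have "cnj c * l2_inner V w f g = of_real ((cmod (l2_inner V w f g))\<^sup>2 / N)"
    using complex_norm_square[of "l2_inner V w f g"] by (simp add: c_def mult.commute)
  then have "Re (cnj c * l2_inner V w f g) = (cmod (l2_inner V w f g))\<^sup>2 / N"
    by (metis Re_complex_of_real)
  moreover have "(cmod c)\<^sup>2 * N = (cmod (l2_inner V w f g))\<^sup>2 / N"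
    using \<open>N > 0\<close> by (simp add: c_def norm_divide power2_eq_square)
  moreover have "0 \<le> (l2_norm V w (\<lambda>x. f x - c * g x))\<^sup>2" by simp
  ultimately have "(cmod (l2_inner V w f g))\<^sup>2 / N \<le> (l2_norm V w f)\<^sup>2"
    unfolding l2_norm_sq_diff_scale[OF assms] N_def[symmetric] by linarith
  then have "(cmod (l2_inner V w f g))\<^sup>2 \<le> (l2_norm V w f * l2_norm V w g)\<^sup>2"
    using \<open>N > 0\<close> by (simp add: N_def field_simps power_mult_distrib)
  then show ?thesis by (rule power2_le_imp_le) simp
qed

lemma l2_triangle:
  assumes "f \<in> l2_space V w" "g \<in> l2_space V w"
  shows "l2_norm V w (\<lambda>x. f x + g x) \<le> l2_norm V w f + l2_norm V w g"
proof (rule power2_le_imp_le)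
  have "Re (l2_inner V w f g) \<le> l2_norm V w f * l2_norm V w g"
    using l2_Cauchy_Schwarz[OF assms] complex_Re_le_cmod order_trans by blast
  then show "(l2_norm V w (\<lambda>x. f x + g x))\<^sup>2 \<le> (l2_norm V w f + l2_norm V w g)\<^sup>2"
    by (simp add: l2_norm_sq_add[OF assms] power2_sum)
qed simp

lemma l2_triangle_diff:
  assumes "f \<in> l2_space V w" "g \<in> l2_space V w" "h \<in> l2_space V w"
  shows "l2_norm V w (\<lambda>x. f x - h x) \<le> l2_norm V w (\<lambda>x. f x - g x) + l2_norm V w (\<lambda>x. g x - h x)"
  using l2_triangle[OF l2_diff[OF assms(1,2)] l2_diff[OF assms(2,3)]] by simp

lemma l2_parallelogram:
  assumes "f \<in> l2_space V w" "g \<in> l2_space V w"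
  shows "(l2_norm V w (\<lambda>x. f x - g x))\<^sup>2 + (l2_norm V w (\<lambda>x. f x + g x))\<^sup>2
    = 2 * (l2_norm V w f)\<^sup>2 + 2 * (l2_norm V w g)\<^sup>2"
  using l2_norm_sq_diff_scale[OF assms, of 1] l2_norm_sq_add[OF assms] by simp

section \<open>Norm limits, completeness and orthogonal projection\<close>

definition l2_limit :: "(nat \<Rightarrow> 'v \<Rightarrow> complex) \<Rightarrow> ('v \<Rightarrow> complex) \<Rightarrow> bool" where
  "l2_limit s f \<longleftrightarrow> (\<lambda>n. l2_norm V w (\<lambda>x. s n x - f x)) \<longlonglongrightarrow> 0"

text \<open>The norm controls each coordinate: |s n x - f x|^2 is at most the squared distance
  divided by \<open>w x\<close>.\<close>

lemma l2_limit_pointwise: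
  assumes "\<And>n. s n \<in> l2_space V w" "f \<in> l2_space V w" "l2_limit s f"
  shows "(\<lambda>n. s n x) \<longlonglongrightarrow> f x"
proof (cases "x \<in> V")
  case True
  have "(\<lambda>n. (l2_norm V w (\<lambda>x. s n x - f x))\<^sup>2 / w x) \<longlonglongrightarrow> 0\<^sup>2 / w x"
    using assms(3) weight_pos[OF True] unfolding l2_limit_def by (intro tendsto_intros) auto
  then have lim: "(\<lambda>n. (l2_norm V w (\<lambda>x. s n x - f x))\<^sup>2 / w x) \<longlonglongrightarrow> 0" by simp
  have "(cmod (s n x - f x))\<^sup>2 \<le> (l2_norm V w (\<lambda>x. s n x - f x))\<^sup>2 / w x" for n
    using point_le_l2_norm_sq[OF l2_diff[OF assms(1,2)] True] weight_pos[OF True]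
    by (simp add: field_simps)
  then have "(\<lambda>n. (cmod (s n x - f x))\<^sup>2) \<longlonglongrightarrow> 0"
    by (intro Lim_null_comparison[OF _ lim] always_eventually) simp
  then have "(\<lambda>n. sqrt ((cmod (s n x - f x))\<^sup>2)) \<longlonglongrightarrow> sqrt 0" by (rule tendsto_real_sqrt)
  then have "(\<lambda>n. cmod (s n x - f x)) \<longlonglongrightarrow> 0" by simp
  then show ?thesis by (rule LIM_zero_cancel[OF tendsto_norm_zero_cancel])
qed (simp add: l2_spaceD(2)[OF assms(1)] l2_spaceD(2)[OF assms(2)])

text \<open>Coordinates are Cauchy, which gives a pointwise limit. Letting \<open>m\<close> tend to
  infinity in finite partial sums for \<open>s n - s m\<close> carries the Cauchy bound over to the
  distance from that limit.\<close>

lemma l2_complete: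
  assumes s: "\<And>n. s n \<in> l2_space V w"
    and Cauchy: "\<And>\<epsilon>. \<epsilon> > 0 \<Longrightarrow> \<exists>N. \<forall>m\<ge>N. \<forall>n\<ge>N. l2_norm V w (\<lambda>x. s m x - s n x) < \<epsilon>"
  obtains f where "f \<in> l2_space V w" "l2_limit s f"
proof -
  have "Cauchy (\<lambda>n. s n x)" if x: "x \<in> V" for x
  proof (rule metric_CauchyI)
    fix \<epsilon> :: real assume "\<epsilon> > 0"
    \<comment> \<open>The factor \<open>sqrt (w x)\<close> compensates the weight when a coordinate
      is estimated by the norm.\<close>
    then have "\<epsilon> * sqrt (w x) > 0" using weight_pos[OF x] by simp
    then obtain N where N: "\<forall>m\<ge>N. \<forall>n\<ge>N. l2_norm V w (\<lambda>x. s m x - s n x) < \<epsilon> * sqrt (w x)"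
      using Cauchy by meson
    have "dist (s m x) (s n x) < \<epsilon>" if "m \<ge> N" "n \<ge> N" for m n
    proof -
      have "w x * (cmod (s m x - s n x))\<^sup>2 \<le> (l2_norm V w (\<lambda>x. s m x - s n x))\<^sup>2"
        using point_le_l2_norm_sq[OF l2_diff[OF s s] x] .
      also have "\<dots> < (\<epsilon> * sqrt (w x))\<^sup>2" using N that by (intro power_strict_mono) auto
      also have "\<dots> = w x * \<epsilon>\<^sup>2" using weight_pos[OF x] by (simp add: power_mult_distrib)
      finally have "(cmod (s m x - s n x))\<^sup>2 < \<epsilon>\<^sup>2" using weight_pos[OF x] by simp
      then show ?thesis using \<open>\<epsilon> > 0\<close> unfolding dist_norm by (simp add: power2_less_imp_less)
    qed
    then show "\<exists>M. \<forall>m\<ge>M. \<forall>n\<ge>M. dist (s m x) (s n x) < \<epsilon>" by blast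
  qed
  then have "\<exists>l. (\<lambda>n. s n x) \<longlonglongrightarrow> l" if "x \<in> V" for x
    using Cauchy_convergent[of "\<lambda>n. s n x"] that by (simp add: convergent_def)
  then obtain g where g: "\<And>x. x \<in> V \<Longrightarrow> (\<lambda>n. s n x) \<longlonglongrightarrow> g x" by metis
  define f where "f x = (if x \<in> V then g x else 0)" for x
  have lim: "(\<lambda>n. s n x) \<longlonglongrightarrow> f x" for x
    using g l2_spaceD(2)[OF s] by (cases "x \<in> V") (auto simp: f_def)
  \<comment> \<open>Membership and smallness are proved together, since \<open>f\<close> is not yet
    known to be square summable.\<close>
  have key: "\<exists>N. \<forall>n\<ge>N. (\<lambda>x. s n x - f x) \<in> l2_space V w \<and> l2_norm V w (\<lambda>x. s n x - f x) \<le> \<epsilon>"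
    if \<epsilon>: "\<epsilon> > 0" for \<epsilon>
  proof -
    obtain N where N: "\<forall>m\<ge>N. \<forall>n\<ge>N. l2_norm V w (\<lambda>x. s m x - s n x) < \<epsilon>"
      using Cauchy[OF \<epsilon>] by blast
    have "(\<Sum>x\<in>F. w x * (cmod (s n x - f x))\<^sup>2) \<le> \<epsilon>\<^sup>2"
      if n: "n \<ge> N" and F: "finite F" "F \<subseteq> V" for n F
    proof (rule LIMSEQ_le_const2)
      show "(\<lambda>m. \<Sum>x\<in>F. w x * (cmod (s n x - s m x))\<^sup>2) \<longlonglongrightarrow> (\<Sum>x\<in>F. w x * (cmod (s n x - f x))\<^sup>2)"
        by (intro tendsto_intros lim)
      have "(\<Sum>x\<in>F. w x * (cmod (s n x - s m x))\<^sup>2) \<le> \<epsilon>\<^sup>2" if "m \<ge> N" for m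
        using finite_sum_le_l2_norm_sq[OF l2_diff[OF s[of n] s[of m]] F]
          power_mono[of "l2_norm V w (\<lambda>x. s n x - s m x)" \<epsilon> 2] N n that by fastforce
      then show "\<exists>M. \<forall>m\<ge>M. (\<Sum>x\<in>F. w x * (cmod (s n x - s m x))\<^sup>2) \<le> \<epsilon>\<^sup>2" by blast
    qed
    then have "(\<lambda>x. s n x - f x) \<in> l2_space V w \<and> l2_norm V w (\<lambda>x. s n x - f x) \<le> \<epsilon>"
      if "n \<ge> N" for n
      using l2_bounded_sums[of "\<lambda>x. s n x - f x" \<epsilon>] that \<open>\<epsilon> > 0\<close> l2_spaceD(2)[OF s]
      by (auto simp: f_def)
    then show ?thesis by blast
  qed
  obtain N where "(\<lambda>x. s N x - f x) \<in> l2_space V w" using key[of 1] by auto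
  from l2_diff[OF s[of N] this] have "f \<in> l2_space V w" by simp
  moreover have "l2_limit s f"
    unfolding l2_limit_def
  proof (rule LIMSEQ_I)
    fix \<epsilon> :: real assume "\<epsilon> > 0"
    then show "\<exists>N. \<forall>n\<ge>N. norm (l2_norm V w (\<lambda>x. s n x - f x) - 0) < \<epsilon>"
      using key[of "\<epsilon> / 2"] by fastforce
  qed
  ultimately show ?thesis by (rule that)
qed

lemma l2_limit_inner:
  assumes "\<And>n. s n \<in> l2_space V w" "f \<in> l2_space V w" "l2_limit s f" "g \<in> l2_space V w"
  shows "(\<lambda>n. l2_inner V w (s n) g) \<longlonglongrightarrow> l2_inner V w f g"
proof (rule Lim_null_comparison[THEN LIM_zero_cancel])
  show "(\<lambda>n. l2_norm V w (\<lambda>x. s n x - f x) * l2_norm V w g) \<longlonglongrightarrow> 0"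
    using assms(3) unfolding l2_limit_def by (rule tendsto_mult_left_zero)
  show "\<forall>\<^sub>F n in sequentially. norm (l2_inner V w (s n) g - l2_inner V w f g)
      \<le> l2_norm V w (\<lambda>x. s n x - f x) * l2_norm V w g"
    using l2_Cauchy_Schwarz[OF l2_diff[OF assms(1,2)] assms(4)]
    by (simp add: l2_inner_diff_left assms)
qed

text \<open>The limit of a minimizing sequence, Cauchy by the parallelogram law, is the orthogonal
  projection of \<open>h\<close>, so that the difference is orthogonal to the subspace.\<close>

lemma l2_subspace_dense:
  assumes M: "M \<subseteq> l2_space V w" "M \<noteq> {}"
    and add: "\<And>f g. f \<in> M \<Longrightarrow> g \<in> M \<Longrightarrow> (\<lambda>x. f x + g x) \<in> M"
    and scale: "\<And>c f. f \<in> M \<Longrightarrow> (\<lambda>x. c * f x) \<in> M"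
    and orth: "\<And>k. k \<in> l2_space V w \<Longrightarrow> (\<forall>m\<in>M. l2_inner V w m k = 0) \<Longrightarrow> k = (\<lambda>x. 0)"
    and h: "h \<in> l2_space V w"
  obtains s where "\<And>n. s n \<in> M" "l2_limit s h"
proof -
  define D where "D = (\<lambda>m. (l2_norm V w (\<lambda>x. h x - m x))\<^sup>2) ` M"
  define \<delta> where "\<delta> = Inf D"
  have D: "bdd_below D" "D \<noteq> {}"
    using M(2) by (auto simp: D_def intro!: bdd_belowI[where m = 0])
  have \<delta>: "\<delta> \<le> (l2_norm V w (\<lambda>x. h x - m x))\<^sup>2" if "m \<in> M" for m
    unfolding \<delta>_def using that D(1) by (intro cInf_lower) (auto simp: D_def)
  have "\<exists>m\<in>M. (l2_norm V w (\<lambda>x. h x - m x))\<^sup>2 < \<delta> + 1 / real (Suc n)" for n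
    using cInf_lessD[OF D(2), of "\<delta> + 1 / real (Suc n)"] by (auto simp: \<delta>_def D_def)
  then obtain s where s: "\<And>n. s n \<in> M"
    and s_min: "\<And>n. (l2_norm V w (\<lambda>x. h x - s n x))\<^sup>2 < \<delta> + 1 / real (Suc n)" by metis
  have s_l2: "s n \<in> l2_space V w" for n using s M by blast
  have close: "(l2_norm V w (\<lambda>x. s i x - s j x))\<^sup>2 \<le> 2 / real (Suc i) + 2 / real (Suc j)" for i j
  proof -
    \<comment> \<open>The midpoint lies in \<open>M\<close>, so its squared distance from
      \<open>h\<close> is at least \<delta>; the parallelogram law then forces \<open>s i\<close>
      and \<open>s j\<close> close together.\<close>
    have mid: "(\<lambda>x. 1/2 * (s i x + s j x)) \<in> M" by (intro scale add s)
    have "l2_norm V w (\<lambda>x. (h x - s i x) + (h x - s j x))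
        = 2 * l2_norm V w (\<lambda>x. h x - 1/2 * (s i x + s j x))"
      using l2_norm_scale[of 2 "\<lambda>x. h x - 1/2 * (s i x + s j x)"] by (simp add: algebra_simps)
    then have "(l2_norm V w (\<lambda>x. (h x - s i x) + (h x - s j x)))\<^sup>2 \<ge> 4 * \<delta>"
      using \<delta>[OF mid] by (simp add: power_mult_distrib)
    moreover have "l2_norm V w (\<lambda>x. (h x - s i x) - (h x - s j x)) = l2_norm V w (\<lambda>x. s i x - s j x)"
      using l2_norm_minus_commute[of "s i" "s j"] by simp
    ultimately show ?thesis
      using l2_parallelogram[OF l2_diff[OF h s_l2[of i]] l2_diff[OF h s_l2[of j]]]
        s_min[of i] s_min[of j] by simp
  qed
  obtain p where p: "p \<in> l2_space V w" "l2_limit s p"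
  proof (rule l2_complete[OF s_l2])
    fix \<epsilon> :: real assume "\<epsilon> > 0"
    then obtain N where N: "1 / real (Suc N) < \<epsilon>\<^sup>2 / 4"
      using nat_approx_posE[of "\<epsilon>\<^sup>2 / 4"] by auto
    have "l2_norm V w (\<lambda>x. s i x - s j x) < \<epsilon>" if "i \<ge> N" "j \<ge> N" for i j
    proof -
      have "1 / real (Suc i) \<le> 1 / real (Suc N)" "1 / real (Suc j) \<le> 1 / real (Suc N)"
        using that by (auto intro!: divide_left_mono)
      then have "(l2_norm V w (\<lambda>x. s i x - s j x))\<^sup>2 < \<epsilon>\<^sup>2"
        using close[of i j] N by simp
      then show ?thesis using \<open>\<epsilon> > 0\<close> by (simp add: power2_less_imp_less)
    qed
    then show "\<exists>N. \<forall>m\<ge>N. \<forall>n\<ge>N. l2_norm V w (\<lambda>x. s m x - s n x) < \<epsilon>" by blast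
  qed blast
  define k where "k x = h x - p x" for x
  have k: "k \<in> l2_space V w" unfolding k_def by (rule l2_diff[OF h p(1)])
  have "l2_inner V w m k = 0" if m: "m \<in> M" for m
  proof -
    have m_l2: "m \<in> l2_space V w" using m M by blast
    \<comment> \<open>Variational inequality: adding \<open>c * m\<close> to \<open>s n\<close>
      stays in \<open>M\<close>, so it cannot bring the squared distance from \<open>h\<close> below
      \<delta>; the slack 1 / (n + 1) disappears in the limit.\<close>
    have bound: "2 * Re (cnj c * l2_inner V w k m) \<le> (cmod c)\<^sup>2 * (l2_norm V w m)\<^sup>2" for c
    proof (rule LIMSEQ_le)
      have "(\<lambda>n. l2_inner V w h m - l2_inner V w (s n) m) \<longlonglongrightarrow> l2_inner V w h m - l2_inner V w p m"
        by (intro tendsto_intros l2_limit_inner s_l2 p m_l2)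
      then have "(\<lambda>n. l2_inner V w (\<lambda>x. h x - s n x) m) \<longlonglongrightarrow> l2_inner V w k m"
        unfolding k_def by (simp add: l2_inner_diff_left h s_l2 p m_l2)
      then show "(\<lambda>n. 2 * Re (cnj c * l2_inner V w (\<lambda>x. h x - s n x) m))
          \<longlonglongrightarrow> 2 * Re (cnj c * l2_inner V w k m)" by (intro tendsto_intros)
      show "(\<lambda>n. 1 / real (Suc n) + (cmod c)\<^sup>2 * (l2_norm V w m)\<^sup>2)
          \<longlonglongrightarrow> (cmod c)\<^sup>2 * (l2_norm V w m)\<^sup>2"
        using tendsto_add[OF LIMSEQ_inverse_real_of_nat tendsto_const] by (simp add: inverse_eq_divide)
      have "2 * Re (cnj c * l2_inner V w (\<lambda>x. h x - s n x) m)
          \<le> 1 / real (Suc n) + (cmod c)\<^sup>2 * (l2_norm V w m)\<^sup>2" for n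
      proof -
        have "(\<lambda>x. s n x + c * m x) \<in> M" by (intro add scale s m)
        from \<delta>[OF this] have "\<delta> \<le> (l2_norm V w (\<lambda>x. (h x - s n x) - c * m x))\<^sup>2"
          by (simp add: algebra_simps)
        then show ?thesis
          using s_min[of n] l2_norm_sq_diff_scale[OF l2_diff[OF h s_l2[of n]] m_l2, of c] by linarith
      qed
      then show "\<exists>N. \<forall>n\<ge>N. 2 * Re (cnj c * l2_inner V w (\<lambda>x. h x - s n x) m)
          \<le> 1 / real (Suc n) + (cmod c)\<^sup>2 * (l2_norm V w m)\<^sup>2" by blast
    qed
    \<comment> \<open>With \<open>c = t * z\<close> the left side of \<open>bound\<close> is 2 t
      |z|^2, while this \<open>t\<close> makes the right side at most t |z|^2, so
      \<open>z = 0\<close>. The summand 1 keeps the denominator positive when \<open>m\<close> is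
      zero.\<close>
    define z t where "z = l2_inner V w k m" and "t = 1 / ((l2_norm V w m)\<^sup>2 + 1)"
    have "t > 0" by (simp add: t_def add_nonneg_pos)
    have "cnj (of_real t * z) * z = of_real (t * (cmod z)\<^sup>2)"
      using complex_norm_square[of z] by (simp add: mult_ac)
    then have "Re (cnj (of_real t * z) * z) = t * (cmod z)\<^sup>2"
      by (metis Re_complex_of_real)
    then have "2 * t * (cmod z)\<^sup>2 \<le> t * (t * (l2_norm V w m)\<^sup>2) * (cmod z)\<^sup>2"
      using bound[of "of_real t * z", folded z_def] \<open>t > 0\<close>
      by (simp add: norm_mult power_mult_distrib power2_eq_square mult_ac)
    also have "\<dots> \<le> t * 1 * (cmod z)\<^sup>2"
      using \<open>t > 0\<close> by (intro mult_right_mono mult_left_mono) (auto simp: t_def field_simps add_nonneg_pos)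
    finally have "t * (cmod z)\<^sup>2 \<le> 0" by simp
    then have "z = 0" using \<open>t > 0\<close> by (simp add: mult_le_0_iff)
    then show ?thesis using l2_inner_cnj[of m k] by (simp add: z_def)
  qed
  then have "k = (\<lambda>x. 0)" using orth k by blast
  then have "p = h" by (auto simp: k_def fun_eq_iff)
  with p s show ?thesis using that by blast
qed

section \<open>Finitely supported functions\<close>

lemma l2_inner_finite:
  assumes "finite F" "F \<subseteq> V" "\<And>x. x \<notin> F \<Longrightarrow> f x = 0 \<or> g x = 0"
  shows "l2_inner V w f g = (\<Sum>x\<in>F. of_real (w x) * f x * cnj (g x))"
proof -
  have "l2_inner V w f g = (\<Sum>\<^sub>\<infinity>x\<in>F. of_real (w x) * f x * cnj (g x))"
    unfolding l2_inner_def using assms(2,3) by (intro infsum_cong_neutral) auto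
  with assms(1) show ?thesis by simp
qed

text \<open>Not normalised: for \<open>x\<close> in \<open>V\<close> the squared norm is
  \<open>w x\<close>, so pairing with it reads off a value only up to the factor
  \<open>w x\<close>.\<close>

definition unit_fun :: "'v \<Rightarrow> 'v \<Rightarrow> complex" where
  "unit_fun x y = (if y = x then 1 else 0)"

lemma unit_fun_fin_supp: "x \<in> V \<Longrightarrow> unit_fun x \<in> fin_supp_space V"
  by (auto simp: fin_supp_space_def fun_space_def unit_fun_def)

lemma l2_inner_unit_fun: "x \<in> V \<Longrightarrow> l2_inner V w (unit_fun x) g = of_real (w x) * cnj (g x)"
  by (subst l2_inner_finite[of "{x}"]) (auto simp: unit_fun_def)

lemma fin_supp_add:
  assumes "u \<in> fin_supp_space V" "v \<in> fin_supp_space V"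
  shows "(\<lambda>x. u x + v x) \<in> fin_supp_space V"
proof -
  have "finite {x. u x + v x \<noteq> 0}"
    by (rule finite_subset[of _ "{x. u x \<noteq> 0} \<union> {x. v x \<noteq> 0}"])
      (use assms fin_supp_spaceD in auto)
  with assms show ?thesis by (simp add: fin_supp_space_def fun_space_def)
qed

lemma fin_supp_mult:
  assumes "u \<in> fin_supp_space V"
  shows "(\<lambda>x. c x * u x) \<in> fin_supp_space V"
proof -
  have "finite {x. c x * u x \<noteq> 0}"
    by (rule finite_subset[OF _ fin_supp_spaceD(1)[OF assms]]) auto
  with assms show ?thesis by (simp add: fin_supp_space_def fun_space_def)
qed

lemma fin_supp_zero: "(\<lambda>x. 0) \<in> fin_supp_space V"
  by (simp add: fin_supp_space_def fun_space_def)

lemma fin_supp_diff: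
  assumes "u \<in> fin_supp_space V" "v \<in> fin_supp_space V"
  shows "(\<lambda>x. u x - v x) \<in> fin_supp_space V"
  using fin_supp_add[OF assms(1) fin_supp_mult[OF assms(2), of "\<lambda>_. -1"]] by simp

text \<open>Orthogonality to the indicators of points makes every coordinate zero, because the
  weights are positive; the projection argument does the rest.\<close>

lemma fin_supp_dense:
  assumes "f \<in> l2_space V w"
  obtains s where "\<And>n. s n \<in> fin_supp_space V" "l2_limit s f"
proof (rule l2_subspace_dense[OF _ _ fin_supp_add fin_supp_mult _ assms])
  show "fin_supp_space V \<subseteq> l2_space V w" using fin_supp_in_l2 by blast
  show "fin_supp_space V \<noteq> {}" using fin_supp_zero by blast
  fix k assume k: "k \<in> l2_space V w" "\<forall>m\<in>fin_supp_space V. l2_inner V w m k = 0"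
  show "k = (\<lambda>x. 0)"
  proof
    fix x show "k x = 0"
    proof (cases "x \<in> V")
      case True
      then show ?thesis
        using k(2) unit_fun_fin_supp[OF True] l2_inner_unit_fun[OF True, of k] weight_pos[OF True]
        by force
    qed (rule l2_spaceD(2)[OF k(1)])
  qed
next
  fix s assume "\<And>n. s n \<in> fin_supp_space V" "l2_limit s f"
  then show ?thesis by (rule that)
qed

lemma l2_limit_eventually:
  assumes "l2_limit s f" "\<epsilon> > 0"
  shows "\<forall>\<^sub>F n in sequentially. l2_norm V w (\<lambda>x. f x - s n x) < \<epsilon>"
  using order_tendstoD(2)[OF assms(1)[unfolded l2_limit_def] assms(2)]
  by (subst l2_norm_minus_commute)

lemma l2_limit_add_scale:
  assumes "\<And>n. s n \<in> l2_space V w" "f \<in> l2_space V w" "l2_limit s f"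
    and "\<And>n. t n \<in> l2_space V w" "g \<in> l2_space V w" "l2_limit t g"
  shows "l2_limit (\<lambda>n x. s n x + c * t n x) (\<lambda>x. f x + c * g x)"
  unfolding l2_limit_def
proof (rule Lim_null_comparison)
  show "(\<lambda>n. l2_norm V w (\<lambda>x. s n x - f x) + cmod c * l2_norm V w (\<lambda>x. t n x - g x)) \<longlonglongrightarrow> 0"
    using assms(3,6) unfolding l2_limit_def
    by (intro tendsto_add_zero tendsto_mult_right_zero)
  have eq: "s n x + c * t n x - (f x + c * g x) = (s n x - f x) + c * (t n x - g x)" for n x
    by (simp add: algebra_simps)
  have "l2_norm V w (\<lambda>x. s n x + c * t n x - (f x + c * g x))
      \<le> l2_norm V w (\<lambda>x. s n x - f x) + cmod c * l2_norm V w (\<lambda>x. t n x - g x)" for n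
    using l2_triangle[OF l2_diff[OF assms(1)[of n] assms(2)] l2_scale[OF l2_diff[OF assms(4)[of n] assms(5)], of c]]
    by (simp add: l2_norm_scale eq)
  then show "\<forall>\<^sub>F n in sequentially. norm (l2_norm V w (\<lambda>x. s n x + c * t n x - (f x + c * g x)))
      \<le> l2_norm V w (\<lambda>x. s n x - f x) + cmod c * l2_norm V w (\<lambda>x. t n x - g x)"
    by simp
qed

lemma l2_limit_Cauchy:
  assumes "\<And>n. s n \<in> l2_space V w" "f \<in> l2_space V w" "l2_limit s f" "\<epsilon> > 0"
  obtains N where "\<And>m n. m \<ge> N \<Longrightarrow> n \<ge> N \<Longrightarrow> l2_norm V w (\<lambda>x. s m x - s n x) < \<epsilon>"
proof -
  obtain N where N: "\<And>n. n \<ge> N \<Longrightarrow> l2_norm V w (\<lambda>x. f x - s n x) < \<epsilon> / 2"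
    using l2_limit_eventually[OF assms(3), of "\<epsilon> / 2"] assms(4)
    by (auto simp: eventually_sequentially)
  show ?thesis
  proof (rule that)
    fix m n assume "m \<ge> N" "n \<ge> N"
    then show "l2_norm V w (\<lambda>x. s m x - s n x) < \<epsilon>"
      using l2_triangle_diff[OF assms(1)[of m] assms(2) assms(1)[of n]] N[of m] N[of n]
        l2_norm_minus_commute[of f "s m"] by linarith
  qed
qed

end

section \<open>Locally finite Hermitian matrices\<close>

text \<open>\<open>K\<close> is the matrix before division by the weight, so that symmetry for the
  weighted inner product is plain Hermitian symmetry. Together with \<open>row_subset\<close> it
  confines nonzero entries to pairs in \<open>V\<close>.\<close>

locale hermitian_matrix = weighted_l2 V w
  for V :: "'v set" and w :: "'v \<Rightarrow> real" +
  fixes K :: "'v \<Rightarrow> 'v \<Rightarrow> complex"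
  assumes hermitian: "K y x = cnj (K x y)"
    and row_finite: "finite {y. K x y \<noteq> 0}"
    and row_subset: "K x y \<noteq> 0 \<Longrightarrow> y \<in> V"
begin

definition mat_op :: "('v \<Rightarrow> complex) \<Rightarrow> 'v \<Rightarrow> complex" where
  "mat_op u x = (\<Sum>y | K x y \<noteq> 0. K x y * u y) / of_real (w x)"

lemma K_sym_zero: "K x y = 0 \<longleftrightarrow> K y x = 0"
  using hermitian[of x y] by simp

text \<open>Replaces the support of the row by any finite \<open>F\<close> that contains the
  relevant indices, so that double sums can run over one common set.\<close>

lemma weighted_mat_op:
  assumes "x \<in> V" "finite F" "\<And>y. K x y \<noteq> 0 \<Longrightarrow> u y \<noteq> 0 \<Longrightarrow> y \<in> F"
  shows "of_real (w x) * mat_op u x = (\<Sum>y\<in>F. K x y * u y)"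
proof -
  have "(\<Sum>y | K x y \<noteq> 0. K x y * u y) = (\<Sum>y\<in>F. K x y * u y)"
    using assms row_finite by (intro sum.mono_neutral_cong) auto
  then show ?thesis using weight_pos[OF assms(1)] by (simp add: mat_op_def)
qed

lemma mat_op_eq_0:
  assumes "\<And>y. K x y * u y = 0"
  shows "mat_op u x = 0"
  unfolding mat_op_def assms by simp

lemma mat_op_outside: "x \<notin> V \<Longrightarrow> mat_op u x = 0"
  using row_subset[of _ x] K_sym_zero[of x] by (intro mat_op_eq_0) auto

lemma mat_op_add: "mat_op (\<lambda>x. f x + g x) x = mat_op f x + mat_op g x"
  by (simp add: mat_op_def distrib_left sum.distrib add_divide_distrib)

lemma mat_op_scale: "mat_op (\<lambda>x. c * f x) x = c * mat_op f x"
  by (simp add: mat_op_def sum_distrib_left mult.left_commute)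

lemma mat_op_diff: "mat_op (\<lambda>x. f x - g x) x = mat_op f x - mat_op g x"
  using mat_op_add[of f "\<lambda>x. -1 * g x" x] mat_op_scale[of "-1" g x] by simp

lemma mat_op_zero: "mat_op (\<lambda>x. 0) = (\<lambda>x. 0)"
  by (simp add: mat_op_def fun_eq_iff)

text \<open>A nonzero value at \<open>x\<close> needs a nonzero entry linking \<open>x\<close> to
  the support of \<open>u\<close>; by Hermitian symmetry such \<open>x\<close> lie in finitely many
  finite rows.\<close>

lemma mat_op_fin_supp:
  assumes "u \<in> fin_supp_space V"
  shows "mat_op u \<in> fin_supp_space V"
proof -
  have "mat_op u x = 0" if "x \<notin> (\<Union>y\<in>{y. u y \<noteq> 0}. {x. K y x \<noteq> 0})" for x
  proof -
    have "K x y * u y = 0" for y using that K_sym_zero[of x y] by auto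
    then show ?thesis by (rule mat_op_eq_0)
  qed
  then have "{x. mat_op u x \<noteq> 0} \<subseteq> (\<Union>y\<in>{y. u y \<noteq> 0}. {x. K y x \<noteq> 0})" by blast
  then have "finite {x. mat_op u x \<noteq> 0}"
    by (rule finite_subset) (intro finite_UN_I fin_supp_spaceD(1)[OF assms] row_finite)
  then show ?thesis by (simp add: fin_supp_space_def fun_space_def mat_op_outside)
qed

lemma mat_op_tendsto:
  assumes "\<And>x. (\<lambda>n. s n x) \<longlonglongrightarrow> f x"
  shows "(\<lambda>n. mat_op (s n) x) \<longlonglongrightarrow> mat_op f x"
proof -
  have "(\<lambda>n. (\<Sum>y | K x y \<noteq> 0. K x y * s n y) * inverse (of_real (w x)))
      \<longlonglongrightarrow> (\<Sum>y | K x y \<noteq> 0. K x y * f y) * inverse (of_real (w x))"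
    by (intro tendsto_intros assms)
  then show ?thesis by (simp add: mat_op_def divide_inverse)
qed

section \<open>Symmetry and the adjoint\<close>

definition row_hull :: "'v set \<Rightarrow> 'v set" where
  "row_hull S = S \<union> (\<Union>x\<in>S. {y. K x y \<noteq> 0})"

text \<open>The hull serves as a common finite index set: if \<open>u\<close> is supported in
  \<open>S\<close>, then \<open>u\<close> and \<open>mat_op u\<close> vanish outside it, and the
  rows indexed by \<open>S\<close> lie inside it.\<close>

lemma row_hull:
  assumes "finite S" "S \<subseteq> V"
  shows "finite (row_hull S)" "row_hull S \<subseteq> V" "S \<subseteq> row_hull S" "x \<in> S \<Longrightarrow> K x y \<noteq> 0 \<Longrightarrow> y \<in> row_hull S"
  using assms row_finite row_subset by (auto simp: row_hull_def)

lemma l2_inner_mat_op: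
  assumes "finite F" "F \<subseteq> V" "\<And>x. x \<notin> F \<Longrightarrow> u x = 0" "\<And>x. x \<notin> F \<Longrightarrow> mat_op u x = 0 \<or> f x = 0"
  shows "l2_inner V w (mat_op u) f = (\<Sum>x\<in>F. \<Sum>y\<in>F. K x y * u y * cnj (f x))"
proof -
  have "l2_inner V w (mat_op u) f = (\<Sum>x\<in>F. of_real (w x) * mat_op u x * cnj (f x))"
    by (rule l2_inner_finite) (use assms in auto)
  also have "\<dots> = (\<Sum>x\<in>F. (\<Sum>y\<in>F. K x y * u y) * cnj (f x))"
    using assms by (intro sum.cong refl arg_cong2[where f = "(*)"] weighted_mat_op) auto
  finally show ?thesis by (simp add: sum_distrib_right)
qed

text \<open>A discrete Green formula. As \<open>u\<close> has finite support, everything reduces to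
  a double sum over one finite set, in which the order of summation is swapped; \<open>f\<close> may
  be any function.\<close>

lemma mat_op_symmetric:
  assumes "u \<in> fin_supp_space V"
  shows "l2_inner V w (mat_op u) f = l2_inner V w u (mat_op f)"
proof -
  define S where "S = {x. u x \<noteq> 0}"
  define F where "F = row_hull S"
  note S = row_hull[of S, OF fin_supp_spaceD[OF assms, folded S_def], folded F_def]
  have out: "u x = 0" if "x \<notin> F" for x using that S(3) by (auto simp: S_def)
  have "mat_op u x = 0" if "x \<notin> F" for x
  proof -
    have "K x y * u y = 0" for y
      using that S(4)[of y x] K_sym_zero[of x y] by (auto simp: S_def)
    then show ?thesis by (rule mat_op_eq_0)
  qed
  then have "l2_inner V w (mat_op u) f = (\<Sum>x\<in>F. \<Sum>y\<in>F. K x y * u y * cnj (f x))"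
    using S out by (intro l2_inner_mat_op) auto
  also have "\<dots> = (\<Sum>y\<in>F. u y * cnj (\<Sum>x\<in>F. K y x * f x))"
    by (subst sum.swap, rule sum.cong[OF refl])
      (simp add: sum_distrib_left hermitian[symmetric] mult_ac)
  also have "\<dots> = (\<Sum>y\<in>F. of_real (w y) * u y * cnj (mat_op f y))"
  proof (rule sum.cong[OF refl])
    fix y assume "y \<in> F"
    show "u y * cnj (\<Sum>x\<in>F. K y x * f x) = of_real (w y) * u y * cnj (mat_op f y)"
    \<comment> \<open>Only at points of the support of \<open>u\<close> is the whole row known to
      lie in \<open>F\<close>; elsewhere both sides carry the factor \<open>u y = 0\<close>.\<close>
    proof (cases "u y = 0")
      case False
      then have "of_real (w y) * mat_op f y = (\<Sum>x\<in>F. K y x * f x)"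
        using S \<open>y \<in> F\<close> by (intro weighted_mat_op) (auto simp: S_def)
      from arg_cong[OF this, of cnj] show ?thesis by (simp add: mult_ac)
    qed simp
  qed
  also have "\<dots> = l2_inner V w u (mat_op f)"
    using S out by (intro l2_inner_finite[symmetric]) auto
  finally show ?thesis .
qed

text \<open>The maximal realisation, on the largest domain for which the formula stays in the
  space.\<close>

definition max_op :: "'v operator" where
  "max_op = {(f, mat_op f) | f. f \<in> l2_space V w \<and> mat_op f \<in> l2_space V w}"

lemma mat_op_in_max_op: "operator_on mat_op (fin_supp_space V) \<subseteq> max_op"
  by (auto simp: operator_on_def max_op_def fin_supp_in_l2 mat_op_fin_supp)

text \<open>Testing the adjoint relation against indicators of points identifies \<open>g\<close>
  with \<open>mat_op f\<close> pointwise; the other inclusion is the symmetry of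
  \<open>mat_op\<close>.\<close>

lemma adjoint_mat_op: "adjoint_operator V w (operator_on mat_op (fin_supp_space V)) = max_op"
proof (intro equalityI subsetI)
  fix p assume "p \<in> adjoint_operator V w (operator_on mat_op (fin_supp_space V))"
  then obtain f g where p: "p = (f, g)" and fg: "f \<in> l2_space V w" "g \<in> l2_space V w"
    and adj: "\<And>u. u \<in> fin_supp_space V \<Longrightarrow> l2_inner V w (mat_op u) f = l2_inner V w u g"
    by (auto simp: adjoint_operator_def operator_on_def)
  have "g x = mat_op f x" for x
  proof (cases "x \<in> V")
    case True
    have "l2_inner V w (unit_fun x) (mat_op f) = l2_inner V w (unit_fun x) g"
      using adj mat_op_symmetric unit_fun_fin_supp[OF True] by metis
    then show ?thesis using weight_pos[OF True] by (simp add: l2_inner_unit_fun True)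
  qed (use mat_op_outside l2_spaceD(2)[OF fg(2)] in auto)
  then have "g = mat_op f" by (rule ext)
  with p fg show "p \<in> max_op" by (auto simp: max_op_def)
next
  fix p assume "p \<in> max_op"
  then show "p \<in> adjoint_operator V w (operator_on mat_op (fin_supp_space V))"
    by (auto simp: max_op_def adjoint_operator_def operator_on_def mat_op_symmetric)
qed

text \<open>The identity \<open>\<eta> x * \<eta> y = ((\<eta> x)\<^sup>2 + (\<eta> y)\<^sup>2 - (\<eta> x - \<eta> y)\<^sup>2) / 2\<close> turns the form of
  \<open>\<eta> f\<close> into that of \<open>mat_op f\<close> against \<open>\<eta>\<^sup>2 f\<close> plus an error which does not see the diagonal.\<close>

lemma eigenfunction_cutoff:
  assumes f: "f \<in> l2_space V w" "\<And>x. mat_op f x = - of_real \<mu> * f x"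
    and \<eta>: "finite {x. \<eta> x \<noteq> 0}" "{x. \<eta> x \<noteq> 0} \<subseteq> V"
    and \<kappa>: "\<kappa> \<ge> 0" "\<And>x. x \<in> V \<Longrightarrow> (\<Sum>y | K x y \<noteq> 0. (\<eta> x - \<eta> y)\<^sup>2 * cmod (K x y)) \<le> \<kappa> * w x"
  defines "u \<equiv> \<lambda>x. of_real (\<eta> x) * f x"
  shows "u \<in> fin_supp_space V"
    and "Re (l2_inner V w (mat_op u) u) \<le> - \<mu> * (l2_norm V w u)\<^sup>2 + \<kappa> / 2 * (l2_norm V w f)\<^sup>2"
proof -
  define S where "S = {x. \<eta> x \<noteq> 0}"
  define F where "F = row_hull S"
  note S = row_hull[of S, OF \<eta>[folded S_def], folded F_def]
  have "finite {x. u x \<noteq> 0}"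
    by (rule finite_subset[OF _ \<eta>(1)]) (auto simp: u_def)
  moreover have "u x = 0" if "x \<notin> V" for x
    using that \<eta>(2) by (auto simp: u_def)
  ultimately show "u \<in> fin_supp_space V"
    by (simp add: fin_supp_space_def fun_space_def)
  have out: "\<eta> x = 0" if "x \<notin> F" for x using that S(3) by (auto simp: S_def)
  \<comment> \<open>Taking real parts yields a kernel symmetric in \<open>x\<close> and
    \<open>y\<close>, so the two squared terms of the identity contribute equally.\<close>
  define P where "P x y = Re (K x y * f y * cnj (f x))" for x y
  have P_sym: "P y x = P x y" for x y
  proof -
    have "K y x * f x * cnj (f y) = cnj (K x y * f y * cnj (f x))"
      by (simp add: hermitian[of y x] mult_ac)
    then show ?thesis unfolding P_def by (metis cnj.simps(1))
  qed
  define c where "c x y = (\<eta> x - \<eta> y)\<^sup>2 * cmod (K x y)" for x y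
  have c_sym: "c y x = c x y" for x y
    by (simp add: c_def hermitian[of y x] power2_commute)
  \<comment> \<open>At points of \<open>S\<close> the full row lies in \<open>F\<close>, so the
    eigenvalue equation evaluates the sum exactly.\<close>
  have row: "(\<Sum>y\<in>F. P x y) = - \<mu> * (w x * (cmod (f x))\<^sup>2)" if "x \<in> S" for x
  proof -
    have "(\<Sum>y\<in>F. K x y * f y) = of_real (w x) * mat_op f x"
      using that S by (intro weighted_mat_op[symmetric]) auto
    then have "(\<Sum>y\<in>F. K x y * f y * cnj (f x)) = of_real (w x) * mat_op f x * cnj (f x)"
      by (simp add: sum_distrib_right[symmetric])
    also have "\<dots> = of_real (- \<mu> * w x) * (f x * cnj (f x))" by (simp add: f(2) mult_ac)
    also have "\<dots> = of_real (- \<mu> * (w x * (cmod (f x))\<^sup>2))"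
      by (simp add: complex_norm_square[symmetric] mult_ac)
    finally have "(\<Sum>y\<in>F. K x y * f y * cnj (f x)) = of_real (- \<mu> * (w x * (cmod (f x))\<^sup>2))" .
    from arg_cong[OF this, of Re] show ?thesis by (simp add: P_def)
  qed
  have norm_u: "(l2_norm V w u)\<^sup>2 = (\<Sum>x\<in>F. (\<eta> x)\<^sup>2 * (w x * (cmod (f x))\<^sup>2))"
  proof -
    have "(l2_norm V w u)\<^sup>2 = (\<Sum>\<^sub>\<infinity>x\<in>F. (\<eta> x)\<^sup>2 * (w x * (cmod (f x))\<^sup>2))"
      unfolding l2_norm_sq using S(2) out
      by (intro infsum_cong_neutral) (auto simp: u_def norm_mult power_mult_distrib)
    then show ?thesis using S(1) by simp
  qed
  have main: "(\<Sum>x\<in>F. \<Sum>y\<in>F. (\<eta> x)\<^sup>2 * P x y) = - \<mu> * (l2_norm V w u)\<^sup>2"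
    unfolding norm_u sum_distrib_left
  proof (rule sum.cong[OF refl])
    fix x assume "x \<in> F"
    show "(\<Sum>y\<in>F. (\<eta> x)\<^sup>2 * P x y) = - \<mu> * ((\<eta> x)\<^sup>2 * (w x * (cmod (f x))\<^sup>2))"
      using row[of x] by (cases "x \<in> S") (auto simp: S_def sum_distrib_left[symmetric])
  qed
  have main': "(\<Sum>x\<in>F. \<Sum>y\<in>F. (\<eta> y)\<^sup>2 * P x y) = - \<mu> * (l2_norm V w u)\<^sup>2"
    unfolding main[symmetric] by (subst sum.swap) (simp add: P_sym)
  have "l2_inner V w (mat_op u) u = (\<Sum>x\<in>F. \<Sum>y\<in>F. K x y * u y * cnj (u x))"
    using S out by (intro l2_inner_mat_op) (auto simp: u_def)
  also have "\<dots> = (\<Sum>x\<in>F. \<Sum>y\<in>F. of_real (\<eta> x * \<eta> y) * (K x y * f y * cnj (f x)))"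
    by (intro sum.cong refl) (simp add: u_def mult_ac)
  finally have "Re (l2_inner V w (mat_op u) u) = (\<Sum>x\<in>F. \<Sum>y\<in>F. \<eta> x * \<eta> y * P x y)"
    by (simp add: P_def)
  also have "\<dots> = (\<Sum>x\<in>F. \<Sum>y\<in>F. ((\<eta> x)\<^sup>2 * P x y + (\<eta> y)\<^sup>2 * P x y - (\<eta> x - \<eta> y)\<^sup>2 * P x y) / 2)"
    by (intro sum.cong refl) (simp add: power2_diff algebra_simps)
  also have "\<dots> = - \<mu> * (l2_norm V w u)\<^sup>2 - (\<Sum>x\<in>F. \<Sum>y\<in>F. (\<eta> x - \<eta> y)\<^sup>2 * P x y) / 2"
    by (simp add: sum_divide_distrib[symmetric] sum_subtractf sum.distrib main main')
  finally have form: "Re (l2_inner V w (mat_op u) u)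
    = - \<mu> * (l2_norm V w u)\<^sup>2 - (\<Sum>x\<in>F. \<Sum>y\<in>F. (\<eta> x - \<eta> y)\<^sup>2 * P x y) / 2" .
  \<comment> \<open>Error term: |f x| |f y| is at most the mean of the squares, and the symmetry of
    \<open>c\<close> moves all the mass to \<open>x\<close>, where the row bound \<kappa>
    applies.\<close>
  have "- (\<Sum>x\<in>F. \<Sum>y\<in>F. (\<eta> x - \<eta> y)\<^sup>2 * P x y) = (\<Sum>x\<in>F. \<Sum>y\<in>F. (\<eta> x - \<eta> y)\<^sup>2 * - P x y)"
    by (simp add: sum_negf)
  also have "\<dots> \<le> (\<Sum>x\<in>F. \<Sum>y\<in>F. (c x y * (cmod (f x))\<^sup>2 + c x y * (cmod (f y))\<^sup>2) / 2)"
  proof (intro sum_mono)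
    fix x y
    have "- P x y \<le> cmod (K x y * f y * cnj (f x))"
      using abs_Re_le_cmod[of "K x y * f y * cnj (f x)"] by (simp add: P_def)
    also have "\<dots> = cmod (K x y) * (cmod (f x) * cmod (f y))" by (simp add: norm_mult)
    also have "\<dots> \<le> cmod (K x y) * (((cmod (f x))\<^sup>2 + (cmod (f y))\<^sup>2) / 2)"
      using sum_squares_bound[of "cmod (f x)" "cmod (f y)"] by (intro mult_left_mono) auto
    finally have "(\<eta> x - \<eta> y)\<^sup>2 * - P x y
        \<le> (\<eta> x - \<eta> y)\<^sup>2 * (cmod (K x y) * (((cmod (f x))\<^sup>2 + (cmod (f y))\<^sup>2) / 2))"
      by (intro mult_left_mono) auto
    then show "(\<eta> x - \<eta> y)\<^sup>2 * - P x y \<le> (c x y * (cmod (f x))\<^sup>2 + c x y * (cmod (f y))\<^sup>2) / 2"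
      by (simp add: c_def algebra_simps add_divide_distrib)
  qed
  also have "\<dots> = (\<Sum>x\<in>F. \<Sum>y\<in>F. c x y * (cmod (f x))\<^sup>2)"
  proof -
    have "(\<Sum>x\<in>F. \<Sum>y\<in>F. c x y * (cmod (f y))\<^sup>2) = (\<Sum>x\<in>F. \<Sum>y\<in>F. c x y * (cmod (f x))\<^sup>2)"
      by (subst sum.swap) (simp add: c_sym)
    then show ?thesis by (simp add: sum_divide_distrib[symmetric] sum.distrib)
  qed
  also have "\<dots> \<le> (\<Sum>x\<in>F. \<kappa> * (w x * (cmod (f x))\<^sup>2))"
  proof (rule sum_mono)
    fix x assume "x \<in> F"
    have "(\<Sum>y\<in>F. c x y) = (\<Sum>y\<in>F \<inter> {y. K x y \<noteq> 0}. c x y)"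
      by (rule sum.mono_neutral_right[OF S(1)]) (auto simp: c_def)
    also have "\<dots> \<le> (\<Sum>y | K x y \<noteq> 0. c x y)"
      by (rule sum_mono2[OF row_finite]) (auto simp: c_def)
    also have "\<dots> \<le> \<kappa> * w x" unfolding c_def using \<open>x \<in> F\<close> S(2) by (intro \<kappa>(2)) auto
    finally show "(\<Sum>y\<in>F. c x y * (cmod (f x))\<^sup>2) \<le> \<kappa> * (w x * (cmod (f x))\<^sup>2)"
      unfolding sum_distrib_right[symmetric] mult.assoc[symmetric]
      by (rule mult_right_mono) simp
  qed
  also have "\<dots> \<le> \<kappa> * (l2_norm V w f)\<^sup>2"
    unfolding sum_distrib_left[symmetric]
    by (intro mult_left_mono finite_sum_le_l2_norm_sq f \<kappa> S)
  finally show "Re (l2_inner V w (mat_op u) u)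
      \<le> - \<mu> * (l2_norm V w u)\<^sup>2 + \<kappa> / 2 * (l2_norm V w f)\<^sup>2"
    unfolding form by simp
qed

section \<open>Essential self-adjointness from cutoffs of small energy\<close>

text \<open>The finitely supported functions turn out to be a core of \<open>max_op\<close>, so the
  closure of the restricted operator equals its adjoint.\<close>

theorem essentially_self_adjoint_cutoffs:
  assumes bounded: "\<And>u. u \<in> fin_supp_space V \<Longrightarrow>
      Re (l2_inner V w (mat_op u) u) \<ge> - C * (l2_norm V w u)\<^sup>2"
    and \<eta>: "\<And>n. finite {x. \<eta> n x \<noteq> 0}" "\<And>n. {x. \<eta> n x \<noteq> 0} \<subseteq> V"
    and \<eta>_lim: "\<And>x. x \<in> V \<Longrightarrow> (\<lambda>n. \<eta> n x) \<longlonglongrightarrow> 1"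
    and \<kappa>: "\<And>n. \<kappa> n \<ge> 0" "\<kappa> \<longlonglongrightarrow> 0"
    and energy: "\<And>n x. x \<in> V \<Longrightarrow>
      (\<Sum>y | K x y \<noteq> 0. (\<eta> n x - \<eta> n y)\<^sup>2 * cmod (K x y)) \<le> \<kappa> n * w x"
  shows "essentially_self_adjoint V w (operator_on mat_op (fin_supp_space V))"
proof -
  \<comment> \<open>One more than \<open>C\<close>, so that the form of the shifted operator
    dominates the squared norm and the constant in \<open>below\<close> is 1.\<close>
  define \<mu> where "\<mu> = C + 1"
  have kernel: "f = (\<lambda>x. 0)"
    if f: "f \<in> l2_space V w" "\<And>x. mat_op f x = - of_real \<mu> * f x" for f
  proof
    fix x show "f x = 0"
    proof (cases "x \<in> V")
      case x: True
      \<comment> \<open>The lower bound with constant -C and the upper bound with -(C + 1) differ by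
        one squared norm of the cut-off function, which is thus at most the error term.\<close>
      have bound: "(\<eta> n x)\<^sup>2 * (w x * (cmod (f x))\<^sup>2) \<le> \<kappa> n / 2 * (l2_norm V w f)\<^sup>2" for n
      proof -
        let ?u = "\<lambda>x. of_real (\<eta> n x) * f x"
        note cut = eigenfunction_cutoff[OF f \<eta> \<kappa>(1) energy, of n]
        have "(l2_norm V w ?u)\<^sup>2 \<le> \<kappa> n / 2 * (l2_norm V w f)\<^sup>2"
          using bounded[OF cut(1)] cut(2) by (simp add: \<mu>_def algebra_simps)
        then show ?thesis using point_le_l2_norm_sq[OF fin_supp_in_l2[OF cut(1)] x]
          by (simp add: norm_mult power_mult_distrib mult_ac)
      qed
      have lim: "(\<lambda>n. (\<eta> n x)\<^sup>2 * (w x * (cmod (f x))\<^sup>2)) \<longlonglongrightarrow> 1\<^sup>2 * (w x * (cmod (f x))\<^sup>2)"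
        by (intro tendsto_intros \<eta>_lim x)
      have lim': "(\<lambda>n. \<kappa> n / 2 * (l2_norm V w f)\<^sup>2) \<longlonglongrightarrow> 0 / 2 * (l2_norm V w f)\<^sup>2"
        by (intro tendsto_intros \<kappa>) simp
      have "1\<^sup>2 * (w x * (cmod (f x))\<^sup>2) \<le> 0 / 2 * (l2_norm V w f)\<^sup>2"
        by (rule LIMSEQ_le[OF lim lim']) (use bound in blast)
      then have "w x * (cmod (f x))\<^sup>2 \<le> 0" by simp
      then show ?thesis using weight_pos[OF x] by (simp add: mult_le_0_iff)
    qed (rule l2_spaceD(2)[OF f(1)])
  qed
  define B where "B u x = mat_op u x + of_real \<mu> * u x" for u x
  have B_fin: "B u \<in> fin_supp_space V" if "u \<in> fin_supp_space V" for u
    unfolding B_def[abs_def] by (intro fin_supp_add mat_op_fin_supp fin_supp_mult that)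
  have B_diff: "B (\<lambda>x. f x - g x) = (\<lambda>x. B f x - B g x)" for f g
    by (simp add: B_def fun_eq_iff mat_op_diff algebra_simps)
  \<comment> \<open>Coercivity and Cauchy-Schwarz bound the squared norm of \<open>u\<close> by the
    product of the norms of \<open>B u\<close> and \<open>u\<close>; one factor cancels unless it is
    zero.\<close>
  have below: "l2_norm V w u \<le> l2_norm V w (B u)" if u: "u \<in> fin_supp_space V" for u
  proof -
    have u2: "u \<in> l2_space V w" "B u \<in> l2_space V w" "mat_op u \<in> l2_space V w"
      using u B_fin mat_op_fin_supp fin_supp_in_l2 by auto
    have "l2_inner V w (B u) u = l2_inner V w (mat_op u) u + of_real \<mu> * of_real ((l2_norm V w u)\<^sup>2)"
      unfolding B_def[abs_def]
      by (simp add: l2_inner_add_left u2 l2_scale l2_inner_scale_left l2_inner_self_norm)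
    then have "Re (l2_inner V w (B u) u) \<ge> (l2_norm V w u)\<^sup>2"
      using bounded[OF u] by (simp add: \<mu>_def algebra_simps del: of_real_power)
    also have "Re (l2_inner V w (B u) u) \<le> l2_norm V w (B u) * l2_norm V w u"
      using l2_Cauchy_Schwarz[OF u2(2,1)] complex_Re_le_cmod order_trans by blast
    finally have "l2_norm V w u * l2_norm V w u \<le> l2_norm V w (B u) * l2_norm V w u"
      by (simp add: power2_eq_square)
    then show ?thesis
      using l2_norm_nonneg[of u] l2_norm_nonneg[of "B u"]
      by (cases "l2_norm V w u = 0") (auto simp: mult_le_cancel_right)
  qed
  have range_dense: "\<exists>s. (\<forall>n. s n \<in> fin_supp_space V) \<and> l2_limit (\<lambda>n. B (s n)) h"
    if h: "h \<in> l2_space V w" for h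
  proof (rule l2_subspace_dense[of "B ` fin_supp_space V", OF _ _ _ _ _ h])
    show "B ` fin_supp_space V \<subseteq> l2_space V w" using B_fin fin_supp_in_l2 by blast
    show "B ` fin_supp_space V \<noteq> {}" using fin_supp_zero by blast
    fix f g assume "f \<in> B ` fin_supp_space V" "g \<in> B ` fin_supp_space V"
    then obtain u v where uv: "u \<in> fin_supp_space V" "v \<in> fin_supp_space V" "f = B u" "g = B v"
      by blast
    then have "(\<lambda>x. f x + g x) = B (\<lambda>x. u x + v x)"
      by (simp add: B_def fun_eq_iff mat_op_add algebra_simps)
    then show "(\<lambda>x. f x + g x) \<in> B ` fin_supp_space V" using fin_supp_add uv by blast
  next
    fix c f assume "f \<in> B ` fin_supp_space V"
    then obtain u where u: "u \<in> fin_supp_space V" "f = B u" by blast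
    then have "(\<lambda>x. c * f x) = B (\<lambda>x. c * u x)"
      by (simp add: B_def fun_eq_iff mat_op_scale algebra_simps)
    then show "(\<lambda>x. c * f x) \<in> B ` fin_supp_space V" using fin_supp_mult[of u "\<lambda>_. c"] u by blast
  next
    \<comment> \<open>A vector orthogonal to the range solves the eigenvalue equation: against each
      indicator, \<open>B\<close> is moved onto \<open>k\<close> by symmetry.\<close>
    fix k assume k: "k \<in> l2_space V w" "\<forall>m\<in>B ` fin_supp_space V. l2_inner V w m k = 0"
    show "k = (\<lambda>x. 0)"
    proof (rule kernel[OF k(1)])
      fix x show "mat_op k x = - of_real \<mu> * k x"
      proof (cases "x \<in> V")
        case True
        let ?u = "unit_fun x"
        note u = unit_fun_fin_supp[OF True]
        have "0 = l2_inner V w (B ?u) k" using k(2) u by simp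
        also have "\<dots> = l2_inner V w (mat_op ?u) k + of_real \<mu> * l2_inner V w ?u k"
          unfolding B_def[abs_def]
          by (simp add: l2_inner_add_left u mat_op_fin_supp fin_supp_in_l2 l2_scale
              l2_inner_scale_left k)
        also have "\<dots> = of_real (w x) * cnj (mat_op k x + of_real \<mu> * k x)"
          by (simp add: mat_op_symmetric u l2_inner_unit_fun True algebra_simps)
        finally have "mat_op k x + of_real \<mu> * k x = 0"
          using weight_pos[OF True] by (metis complex_cnj_zero_iff less_irrefl mult_eq_0_iff of_real_eq_0_iff)
        then show ?thesis by (simp add: eq_neg_iff_add_eq_0)
      qed (simp add: mat_op_outside l2_spaceD(2)[OF k(1)])
    qed
  next
    fix s assume s: "\<And>n. s n \<in> B ` fin_supp_space V" "l2_limit s h"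
    then have "\<forall>n. \<exists>u\<in>fin_supp_space V. s n = B u" by blast
    then obtain u where "\<forall>n. u n \<in> fin_supp_space V" "s = (\<lambda>n. B (u n))"
      by (metis (no_types) ext)
    with s show ?thesis by blast
  qed
  \<comment> \<open>Approximation in the graph norm: if \<open>B (s n)\<close> tends to
    \<open>B f\<close>, then \<open>s\<close> is Cauchy by \<open>below\<close>, and its limit is
    \<open>f\<close> because \<open>kernel\<close> makes \<open>B\<close> injective on the
    space.\<close>
  have core: "\<exists>s. (\<forall>n. s n \<in> fin_supp_space V) \<and> l2_limit s f \<and> l2_limit (\<lambda>n. mat_op (s n)) (mat_op f)"
    if f: "f \<in> l2_space V w" "mat_op f \<in> l2_space V w" for f
  proof -
    have Bf: "B f \<in> l2_space V w" unfolding B_def[abs_def] by (intro l2_add l2_scale f)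
    obtain s where s: "\<And>n. s n \<in> fin_supp_space V" and Bs: "l2_limit (\<lambda>n. B (s n)) (B f)"
      using range_dense[OF Bf] by blast
    have s2: "s n \<in> l2_space V w" "B (s n) \<in> l2_space V w" for n
      using s B_fin fin_supp_in_l2 by auto
    obtain p where p: "p \<in> l2_space V w" "l2_limit s p"
    proof (rule l2_complete[OF s2(1)])
      fix \<epsilon> :: real assume "\<epsilon> > 0"
      then obtain N where N: "\<And>m n. m \<ge> N \<Longrightarrow> n \<ge> N \<Longrightarrow> l2_norm V w (\<lambda>x. B (s m) x - B (s n) x) < \<epsilon>"
        using l2_limit_Cauchy[OF s2(2) Bf Bs] by blast
      have "l2_norm V w (\<lambda>x. s m x - s n x) < \<epsilon>" if "m \<ge> N" "n \<ge> N" for m n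
        using below[OF fin_supp_diff[OF s[of m] s[of n]]] N[OF that] by (simp add: B_diff)
      then show "\<exists>N. \<forall>m\<ge>N. \<forall>n\<ge>N. l2_norm V w (\<lambda>x. s m x - s n x) < \<epsilon>" by blast
    qed blast
    \<comment> \<open>\<open>mat_op p\<close> is not known to be square summable, so the equation is
      obtained coordinatewise, where finite rows allow passage to the limit.\<close>
    have "B p x = B f x" for x
    proof (rule LIMSEQ_unique)
      show "(\<lambda>n. B (s n) x) \<longlonglongrightarrow> B p x"
        unfolding B_def
        by (intro tendsto_intros mat_op_tendsto l2_limit_pointwise[OF s2(1) p])
      show "(\<lambda>n. B (s n) x) \<longlonglongrightarrow> B f x"
        by (rule l2_limit_pointwise[OF s2(2) Bf Bs])
    qed
    then have "(\<lambda>x. f x - p x) = (\<lambda>x. 0)"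
      by (intro kernel l2_diff f p) (auto simp: B_def mat_op_diff algebra_simps)
    then have "p = f" by (auto simp: fun_eq_iff)
    \<comment> \<open>Subtracting \<mu> times the approximants from their images under
      \<open>B\<close> recovers the convergence of \<open>mat_op (s n)\<close>.\<close>
    moreover have "l2_limit (\<lambda>n x. B (s n) x + - of_real \<mu> * s n x) (\<lambda>x. B f x + - of_real \<mu> * p x)"
      by (rule l2_limit_add_scale[OF s2(2) Bf Bs s2(1) p])
    ultimately show ?thesis using s p by (auto simp: B_def)
  qed
  let ?T = "operator_on mat_op (fin_supp_space V)"
  \<comment> \<open>One inclusion is the closedness of \<open>max_op\<close>, seen coordinatewise;
    the other is \<open>core\<close>.\<close>
  have closure: "operator_closure V w ?T = max_op"
  proof (intro equalityI subsetI)
    fix z assume "z \<in> operator_closure V w ?T"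
    then obtain f g where z: "z = (f, g)" and fg: "f \<in> l2_space V w" "g \<in> l2_space V w"
      and close: "\<And>\<epsilon>. \<epsilon> > 0 \<Longrightarrow> \<exists>u\<in>fin_supp_space V.
        l2_norm V w (\<lambda>x. f x - u x) < \<epsilon> \<and> l2_norm V w (\<lambda>x. g x - mat_op u x) < \<epsilon>"
      by (auto simp: operator_closure_def operator_on_def Bex_def)
    have "\<exists>u\<in>fin_supp_space V. l2_norm V w (\<lambda>x. f x - u x) < inverse (real (Suc n))
        \<and> l2_norm V w (\<lambda>x. g x - mat_op u x) < inverse (real (Suc n))" for n
      by (rule close) simp
    then obtain s where s: "\<And>n. s n \<in> fin_supp_space V"
      and s_close: "\<And>n. l2_norm V w (\<lambda>x. s n x - f x) < inverse (real (Suc n))"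
        "\<And>n. l2_norm V w (\<lambda>x. mat_op (s n) x - g x) < inverse (real (Suc n))"
      unfolding l2_norm_minus_commute[of f] l2_norm_minus_commute[of g] by metis
    have s2: "s n \<in> l2_space V w" "mat_op (s n) \<in> l2_space V w" for n
      using s mat_op_fin_supp fin_supp_in_l2 by auto
    have lim: "l2_limit s f" "l2_limit (\<lambda>n. mat_op (s n)) g"
      unfolding l2_limit_def
      by (auto intro!: Lim_null_comparison[OF _ LIMSEQ_inverse_real_of_nat] always_eventually
          less_imp_le s_close simp del: of_nat_Suc)
    have "g x = mat_op f x" for x
      using LIMSEQ_unique[OF l2_limit_pointwise[OF s2(2) fg(2) lim(2)]
          mat_op_tendsto[OF l2_limit_pointwise[OF s2(1) fg(1) lim(1)]]] .
    then have "g = mat_op f" by (rule ext)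
    with z fg show "z \<in> max_op" by (auto simp: max_op_def)
  next
    fix z assume "z \<in> max_op"
    then obtain f where z: "z = (f, mat_op f)" and f: "f \<in> l2_space V w" "mat_op f \<in> l2_space V w"
      by (auto simp: max_op_def)
    obtain s where s: "\<And>n. s n \<in> fin_supp_space V" "l2_limit s f"
      "l2_limit (\<lambda>n. mat_op (s n)) (mat_op f)" using core[OF f] by blast
    have "\<exists>u\<in>fin_supp_space V. l2_norm V w (\<lambda>x. f x - u x) < \<epsilon>
        \<and> l2_norm V w (\<lambda>x. mat_op f x - mat_op u x) < \<epsilon>" if "\<epsilon> > 0" for \<epsilon>
      using eventually_happens[OF eventually_conj[OF l2_limit_eventually[OF s(2) that]
            l2_limit_eventually[OF s(3) that]]] s(1) by auto
    then show "z \<in> operator_closure V w ?T"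
      using z f by (auto simp: operator_closure_def operator_on_def Bex_def)
  qed
  \<comment> \<open>Enlarging an operator shrinks its adjoint, which gives one inclusion; the other
    extends symmetry from finitely supported functions by means of \<open>core\<close>.\<close>
  have adjoint: "adjoint_operator V w max_op = max_op"
  proof (intro equalityI subsetI)
    fix z assume "z \<in> adjoint_operator V w max_op"
    then have "z \<in> adjoint_operator V w ?T"
      using mat_op_in_max_op by (auto simp: adjoint_operator_def)
    then show "z \<in> max_op" by (simp add: adjoint_mat_op)
  next
    fix z assume "z \<in> max_op"
    then obtain f where z: "z = (f, mat_op f)" and f: "f \<in> l2_space V w" "mat_op f \<in> l2_space V w"
      by (auto simp: max_op_def)
    have "l2_inner V w (mat_op u) f = l2_inner V w u (mat_op f)"
      if u: "u \<in> l2_space V w" "mat_op u \<in> l2_space V w" for u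
    proof -
      obtain s where s: "\<And>n. s n \<in> fin_supp_space V" "l2_limit s u"
        "l2_limit (\<lambda>n. mat_op (s n)) (mat_op u)" using core[OF u] by blast
      have s2: "s n \<in> l2_space V w" "mat_op (s n) \<in> l2_space V w" for n
        using s mat_op_fin_supp fin_supp_in_l2 by auto
      show ?thesis
        using LIMSEQ_unique[OF l2_limit_inner[OF s2(2) u(2) s(3) f(1)]]
          l2_limit_inner[OF s2(1) u(1) s(2) f(2)] by (simp add: mat_op_symmetric[OF s(1)])
    qed
    then show "z \<in> adjoint_operator V w max_op"
      using z f by (auto simp: adjoint_operator_def max_op_def)
  qed
  have dense: "densely_defined V w S" if "?T \<subseteq> S" for S
    unfolding densely_defined_def
  proof (intro ballI allI impI)
    fix f \<epsilon> assume f: "f \<in> l2_space V w" and \<epsilon>: "(0::real) < \<epsilon>"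
    obtain s where s: "\<And>n. s n \<in> fin_supp_space V" "l2_limit s f"
      using fin_supp_dense[OF f] by blast
    then obtain n where "l2_norm V w (\<lambda>x. f x - s n x) < \<epsilon>"
      using eventually_happens[OF l2_limit_eventually[OF s(2) \<epsilon>]] by auto
    then show "\<exists>u\<in>Domain S. l2_norm V w (\<lambda>x. f x - u x) < \<epsilon>"
      using s(1)[of n] that by (auto simp: operator_on_def)
  qed
  have "linear_operator V w ?T"
    using mat_op_zero fin_supp_zero
    by (auto simp: linear_operator_def operator_on_def single_valued_def fin_supp_in_l2
        mat_op_fin_supp mat_op_add[abs_def] mat_op_scale[abs_def] fin_supp_add fin_supp_mult)
  moreover have "linear_operator V w max_op"
    using mat_op_zero l2_zero
    by (auto simp: linear_operator_def max_op_def single_valued_def mat_op_add[abs_def]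
        mat_op_scale[abs_def] l2_add l2_scale)
  ultimately show ?thesis
    using dense mat_op_in_max_op adjoint
    by (simp add: essentially_self_adjoint_def symmetric_operator_def self_adjoint_def
        closure adjoint_mat_op)
qed

end

section \<open>Distances and balls in the graph\<close>

locale weighted_graph =
  fixes V :: "'v set" and E :: "'v set set" and Es :: "('v \<times> 'v) set"
    and w :: "'v \<Rightarrow> real" and a :: "'v \<times> 'v \<Rightarrow> real"
  assumes simple: "simple_graph V E"
    and infinite: "infinite V"
    and locally_finite: "locally_finite V E"
    and connected: "connected_graph V E"
    and orientation: "is_orientation E Es"
    and weights: "graph_weights V E w a"
begin

lemma edge_in_V:
  assumes "(x, y) \<in> oriented_edges E"
  shows "x \<in> V" "y \<in> V"
  using assms simple by (auto simp: oriented_edges_def simple_graph_def)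

lemma edge_sym: "(x, y) \<in> oriented_edges E \<Longrightarrow> (y, x) \<in> oriented_edges E"
  by (auto simp: oriented_edges_def insert_commute)

lemma edge_weight:
  assumes "(x, y) \<in> oriented_edges E"
  shows "a (x, y) > 0" "a (y, x) = a (x, y)"
  using assms weights by (auto simp: graph_weights_def)

text \<open>The map from \<open>y\<close> to \<open>{x, y}\<close> embeds the neighbours of
  \<open>x\<close> into the edges at \<open>x\<close>; vertices outside \<open>V\<close> have no
  neighbours.\<close>

lemma neighbours_finite: "finite (oriented_edges E `` {x})"
  and card_neighbours: "x \<in> V \<Longrightarrow> card (oriented_edges E `` {x}) \<le> degree E x"
proof -
  have inj: "inj_on (\<lambda>y. {x, y}) (oriented_edges E `` {x})"
    by (auto simp: inj_on_def doubleton_eq_iff oriented_edges_def)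
  have sub: "(\<lambda>y. {x, y}) ` (oriented_edges E `` {x}) \<subseteq> {e \<in> E. x \<in> e}"
    by (auto simp: oriented_edges_def)
  have fin: "finite {e \<in> E. x \<in> e}" if "x \<in> V"
    using locally_finite that by (simp add: locally_finite_def)
  show "finite (oriented_edges E `` {x})"
  proof (cases "x \<in> V")
    case True
    then show ?thesis using finite_imageD[OF finite_subset[OF sub fin] inj] by blast
  next
    case False
    then have "oriented_edges E `` {x} = {}" using edge_in_V by blast
    then show ?thesis by simp
  qed
  show "card (oriented_edges E `` {x}) \<le> degree E x" if "x \<in> V"
    unfolding degree_def using card_inj_on_le[OF inj sub fin[OF that]] .
qed

text \<open>The edge or its reversal belongs to the orientation, and both have the same weight. This
  links arbitrary neighbours to \<open>max_weight_ratio\<close>, which ranges over \<open>Es\<close>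
  only.\<close>

lemma oriented_edge_incident:
  assumes "(x, y) \<in> oriented_edges E"
  obtains e where "e \<in> Es" "incident e x" "a e = a (x, y)"
proof -
  have "(x, y) \<in> Es \<or> (y, x) \<in> Es"
    using assms orientation by (auto simp: is_orientation_def)
  then show ?thesis
    using that[of "(x, y)"] that[of "(y, x)"] edge_weight(2)[OF assms] by (auto simp: incident_def)
qed

lemma finite_incident: "finite {e \<in> Es. incident e x}"
proof (rule finite_subset)
  show "{e \<in> Es. incident e x} \<subseteq> {x} \<times> (oriented_edges E `` {x}) \<union> (oriented_edges E `` {x}) \<times> {x}"
    using orientation edge_sym by (auto simp: is_orientation_def incident_def)
  show "finite ({x} \<times> (oriented_edges E `` {x}) \<union> (oriented_edges E `` {x}) \<times> {x})"
    using neighbours_finite by blast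
qed

lemma graph_dist_path:
  assumes "x \<in> V" "y \<in> V"
  shows "(x, y) \<in> oriented_edges E ^^ graph_dist E x y"
proof -
  have "\<exists>n. (x, y) \<in> oriented_edges E ^^ n"
    using connected assms by (simp add: connected_graph_def rtrancl_power)
  then show ?thesis unfolding graph_dist_def by (rule LeastI_ex)
qed

lemma graph_dist_edge:
  assumes "z \<in> V" "(x, y) \<in> oriented_edges E"
  shows "graph_dist E z y \<le> Suc (graph_dist E z x)"
proof -
  have "(z, y) \<in> oriented_edges E ^^ Suc (graph_dist E z x)"
    using graph_dist_path[OF assms(1) edge_in_V(1)[OF assms(2)]] assms(2) by auto
  then show ?thesis unfolding graph_dist_def[of E z y] by (rule Least_le)
qed

text \<open>By local finiteness and induction only finitely many vertices are reachable in exactly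
  \<open>k\<close> steps; the ball is covered by these sets for \<open>k\<close> up to
  \<open>n\<close>.\<close>

lemma finite_graph_ball:
  assumes "z \<in> V"
  shows "finite (graph_ball V E z n)"
proof -
  have fin: "finite ((oriented_edges E ^^ k) `` {z})" for k
  proof (induction k)
    case (Suc k)
    have "(oriented_edges E ^^ Suc k) `` {z}
        = (\<Union>x\<in>(oriented_edges E ^^ k) `` {z}. oriented_edges E `` {x})" by auto
    then show ?case using Suc neighbours_finite by simp
  qed simp
  show ?thesis
  proof (rule finite_subset)
    show "graph_ball V E z n \<subseteq> (\<Union>k\<le>n. (oriented_edges E ^^ k) `` {z})"
      using graph_dist_path[OF assms] by (auto simp: graph_ball_def)
    show "finite (\<Union>k\<le>n. (oriented_edges E ^^ k) `` {z})" using fin by blast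
  qed
qed

lemma card_neighbours_ball:
  assumes "z \<in> V" "x \<in> graph_ball V E z n"
  shows "card (oriented_edges E `` {x}) \<le> max_degree V E z n"
proof -
  have "degree E x \<le> max_degree V E z n"
    unfolding max_degree_def using assms finite_graph_ball by (intro Max_ge) auto
  then show ?thesis using card_neighbours[of x] assms(2) by (simp add: graph_ball_def)
qed

lemma edge_weight_ball:
  assumes "z \<in> V" "x \<in> graph_ball V E z n" "(x, y) \<in> oriented_edges E"
  shows "a (x, y) \<le> max_weight_ratio V E Es w a z n * w x"
proof -
  obtain e where e: "e \<in> Es" "incident e x" "a e = a (x, y)"
    using oriented_edge_incident[OF assms(3)] .
  have "a e / w x \<le> Max ((\<lambda>e. a e / w x) ` {e \<in> Es. incident e x})"
    using e finite_incident unfolding e(3)[symmetric] by (intro Max_ge finite_imageI imageI) auto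
  also have "\<dots> \<le> max_weight_ratio V E Es w a z n"
    unfolding max_weight_ratio_def using assms finite_graph_ball by (intro Max_ge) auto
  finally show ?thesis
    using e(3) weights edge_in_V(1)[OF assms(3)] by (simp add: graph_weights_def field_simps)
qed

text \<open>An infinite connected graph has an edge at \<open>z\<close>, and the positive weight of
  that edge bounds the maximum from below.\<close>

lemma max_weight_ratio_pos:
  assumes "z \<in> V"
  shows "max_weight_ratio V E Es w a z n > 0"
proof -
  have "V \<noteq> {z}" using infinite by auto
  then obtain y where "y \<in> V" "y \<noteq> z" using assms by blast
  then have "(z, y) \<in> (oriented_edges E)\<^sup>*" using connected assms by (auto simp: connected_graph_def)
  then obtain y' where y': "(z, y') \<in> oriented_edges E"
    using \<open>y \<noteq> z\<close> by (auto elim: converse_rtranclE)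
  have "graph_dist E z z = 0"
    unfolding graph_dist_def by (rule Least_eq_0) simp
  then have "z \<in> graph_ball V E z n" using assms by (simp add: graph_ball_def)
  then have "0 < max_weight_ratio V E Es w a z n * w z"
    using edge_weight_ball[OF assms _ y'] edge_weight(1)[OF y'] by fastforce
  moreover have "w z > 0" using weights assms by (simp add: graph_weights_def)
  ultimately show ?thesis by (rule zero_less_mult_pos2)
qed

section \<open>Radial cutoffs and their energy\<close>

text \<open>Linear decay makes the slope along every edge at most 1 / n. For \<open>n = 0\<close>
  division by zero turns the cone into the constant 1 on \<open>V\<close>, hence the hypothesis
  \<open>n > 0\<close> below.\<close>

definition cone :: "'v \<Rightarrow> nat \<Rightarrow> 'v \<Rightarrow> real" where
  "cone z n x = (if x \<in> V then max 0 (1 - real (graph_dist E z x) / real n) else 0)"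

lemma cone_support: "n > 0 \<Longrightarrow> {x. cone z n x \<noteq> 0} \<subseteq> graph_ball V E z n"
  by (auto simp: cone_def graph_ball_def max_def field_simps split: if_splits)

lemma cone_edge:
  assumes "z \<in> V" "(x, y) \<in> oriented_edges E" "n > 0"
  shows "(cone z n x - cone z n y)\<^sup>2 \<le> 1 / (real n)\<^sup>2"
proof -
  let ?r = "\<lambda>x. real (graph_dist E z x) / real n"
  have "\<bar>real (graph_dist E z x) - real (graph_dist E z y)\<bar> \<le> 1"
    using graph_dist_edge[OF assms(1,2)] graph_dist_edge[OF assms(1) edge_sym[OF assms(2)]] by linarith
  then have "\<bar>real (graph_dist E z x) - real (graph_dist E z y)\<bar> / real n \<le> 1 / real n"
    by (rule divide_right_mono) simp
  then have "\<bar>?r x - ?r y\<bar> \<le> 1 / real n"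
    by (simp add: diff_divide_distrib[symmetric])
  then have "\<bar>cone z n x - cone z n y\<bar> \<le> 1 / real n"
    using edge_in_V[OF assms(2)] unfolding cone_def by (auto simp: max_def split: if_splits)
  from power_mono[OF this, of 2] show ?thesis by (simp add: power_divide)
qed

text \<open>A neighbour of a vertex at distance above \<open>n\<close> is at distance at least
  \<open>n\<close>, where the cone is already zero. Rows outside the ball thus carry no energy, and
  the maxima at radius \<open>n\<close> suffice.\<close>

lemma cone_edge_outside:
  assumes "z \<in> V" "(x, y) \<in> oriented_edges E" "n > 0" "x \<notin> graph_ball V E z n"
  shows "cone z n x = 0" "cone z n y = 0"
proof -
  have "graph_dist E z x > n" using assms edge_in_V by (auto simp: graph_ball_def)
  moreover from this have "graph_dist E z y \<ge> n"
    using graph_dist_edge[OF assms(1) edge_sym[OF assms(2)]] by simp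
  ultimately show "cone z n x = 0" "cone z n y = 0"
    using assms(3) by (auto simp: cone_def max_def field_simps)
qed

text \<open>For \<open>x\<close> in the ball there are at most \<open>max_degree\<close> terms, each
  at most 1 / n^2 times the maximal ratio times \<open>w x\<close>.\<close>

lemma cone_energy:
  assumes "z \<in> V" "x \<in> V" "n > 0"
  shows "(\<Sum>y\<in>oriented_edges E `` {x}. (cone z n x - cone z n y)\<^sup>2 * a (x, y))
    \<le> real (max_degree V E z n) * max_weight_ratio V E Es w a z n / (real n)\<^sup>2 * w x"
    (is "?lhs \<le> ?rhs")
proof -
  have wx: "w x > 0" using weights assms(2) by (simp add: graph_weights_def)
  have ratio: "max_weight_ratio V E Es w a z n > 0" by (rule max_weight_ratio_pos[OF assms(1)])
  show ?thesis
  proof (cases "x \<in> graph_ball V E z n")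
    case True
    have "?lhs \<le> (\<Sum>y\<in>oriented_edges E `` {x}. 1 / (real n)\<^sup>2 * (max_weight_ratio V E Es w a z n * w x))"
      using True assms cone_edge edge_weight_ball edge_weight(1)
      by (intro sum_mono mult_mono) (auto intro: less_imp_le)
    also have "\<dots> = real (card (oriented_edges E `` {x}))
        * (1 / (real n)\<^sup>2 * (max_weight_ratio V E Es w a z n * w x))" by simp
    also have "\<dots> \<le> real (max_degree V E z n)
        * (1 / (real n)\<^sup>2 * (max_weight_ratio V E Es w a z n * w x))"
      using card_neighbours_ball[OF assms(1) True] wx ratio by (intro mult_right_mono) auto
    finally show ?thesis by simp
  next
    case False
    have "?lhs = 0"
      using cone_edge_outside[OF assms(1) _ assms(3) False] by (intro sum.neutral) auto
    then show ?thesis using wx ratio by simp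
  qed
qed

section \<open>The matrix of the magnetic Schroedinger operator\<close>

text \<open>The matrix of \<open>H\<close> multiplied by the weight. The phase sits on the reversed
  edge \<open>(y, x)\<close>, as in the Laplacian.\<close>

definition schroedinger_matrix :: "('v \<times> 'v \<Rightarrow> complex) \<Rightarrow> ('v \<Rightarrow> real) \<Rightarrow> 'v \<Rightarrow> 'v \<Rightarrow> complex" where
  "schroedinger_matrix \<sigma> q x y =
    (if x = y then (if x \<in> V then of_real (w x * q x + (\<Sum>z\<in>oriented_edges E `` {x}. a (x, z))) else 0)
     else if (x, y) \<in> oriented_edges E then - of_real (a (x, y)) * \<sigma> (y, x) else 0)"

lemma not_edge_self: "(x, x) \<notin> oriented_edges E"
  by (simp add: oriented_edges_def)

lemma schroedinger_matrix_row:
  "{y. schroedinger_matrix \<sigma> q x y \<noteq> 0} \<subseteq> insert x (oriented_edges E `` {x})"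
  by (auto simp: schroedinger_matrix_def split: if_splits)

lemma hermitian_schroedinger_matrix:
  assumes "magnetic_phase E \<sigma>"
  shows "hermitian_matrix V w (schroedinger_matrix \<sigma> q)"
proof
  show "w x > 0" if "x \<in> V" for x using that weights by (simp add: graph_weights_def)
  show "schroedinger_matrix \<sigma> q y x = cnj (schroedinger_matrix \<sigma> q x y)" for x y
    using assms edge_sym edge_weight(2)[of x y]
    by (auto simp: schroedinger_matrix_def magnetic_phase_def)
  show "finite {y. schroedinger_matrix \<sigma> q x y \<noteq> 0}" for x
    by (rule finite_subset[OF schroedinger_matrix_row]) (simp add: neighbours_finite)
  show "y \<in> V" if "schroedinger_matrix \<sigma> q x y \<noteq> 0" for x y
    using that edge_in_V by (auto simp: schroedinger_matrix_def split: if_splits)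
qed

text \<open>Membership in \<open>fun_space V\<close> kills the potential term outside
  \<open>V\<close>, where \<open>mat_op\<close> vanishes.\<close>

lemma magnetic_schroedinger_eq_mat_op:
  assumes "magnetic_phase E \<sigma>" "u \<in> fun_space V"
  shows "magnetic_schroedinger V E w a \<sigma> q u
    = hermitian_matrix.mat_op w (schroedinger_matrix \<sigma> q) u"
proof
  interpret hermitian_matrix V w "schroedinger_matrix \<sigma> q"
    by (rule hermitian_schroedinger_matrix[OF assms(1)])
  let ?N = "\<lambda>x. oriented_edges E `` {x}"
  fix x show "magnetic_schroedinger V E w a \<sigma> q u x = mat_op u x"
  proof (cases "x \<in> V")
    case True
    have out: "out_edges E x = Pair x ` ?N x"
      by (auto simp: out_edges_def)
    have "(\<Sum>e\<in>out_edges E x. of_real (a e) * (u x - \<sigma> (prod.swap e) * u (snd e)))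
        = (\<Sum>y\<in>?N x. of_real (a (x, y)) * (u x - \<sigma> (y, x) * u y))"
      unfolding out by (subst sum.reindex) (auto simp: inj_on_def)
    also have "\<dots> = of_real (\<Sum>y\<in>?N x. a (x, y)) * u x
        + (\<Sum>y\<in>?N x. schroedinger_matrix \<sigma> q x y * u y)"
      unfolding of_real_sum sum_distrib_right sum.distrib[symmetric]
      by (intro sum.cong refl) (auto simp: schroedinger_matrix_def not_edge_self algebra_simps)
    \<comment> \<open>The diagonal entry is the total edge weight at \<open>x\<close> plus
      \<open>w x * q x\<close>; adding and subtracting the latter completes the row.\<close>
    also have "\<dots> = (\<Sum>y\<in>insert x (?N x). schroedinger_matrix \<sigma> q x y * u y) - of_real (w x * q x) * u x"
      using True not_edge_self neighbours_finite
      by (subst sum.insert) (auto simp: schroedinger_matrix_def[of _ _ x x] algebra_simps)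
    also have "(\<Sum>y\<in>insert x (?N x). schroedinger_matrix \<sigma> q x y * u y) = of_real (w x) * mat_op u x"
      using True schroedinger_matrix_row neighbours_finite
      by (intro weighted_mat_op[symmetric]) auto
    finally show ?thesis
      using True weight_pos[OF True]
      by (simp add: magnetic_schroedinger_def magnetic_laplacian_def field_simps)
  next
    case False
    then show ?thesis using assms(2)
      by (simp add: magnetic_schroedinger_def magnetic_laplacian_def mat_op_outside fun_space_def)
  qed
qed

text \<open>The diagonal drops out because \<eta> x - \<eta> x = 0, and phases have modulus 1, so
  neither \<open>q\<close> nor \<sigma> enters the energy.\<close>

lemma schroedinger_matrix_energy:
  assumes "magnetic_phase E \<sigma>"
  shows "(\<Sum>y | schroedinger_matrix \<sigma> q x y \<noteq> 0. (\<eta> x - \<eta> y)\<^sup>2 * cmod (schroedinger_matrix \<sigma> q x y))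
    = (\<Sum>y\<in>oriented_edges E `` {x}. (\<eta> x - \<eta> y)\<^sup>2 * a (x, y))" (is "?lhs = _")
proof -
  have "?lhs = (\<Sum>y\<in>insert x (oriented_edges E `` {x}). (\<eta> x - \<eta> y)\<^sup>2 * cmod (schroedinger_matrix \<sigma> q x y))"
    using schroedinger_matrix_row neighbours_finite by (intro sum.mono_neutral_left) auto
  also have "\<dots> = (\<Sum>y\<in>oriented_edges E `` {x}. (\<eta> x - \<eta> y)\<^sup>2 * cmod (schroedinger_matrix \<sigma> q x y))"
    using not_edge_self neighbours_finite by (subst sum.insert) auto
  also have "\<dots> = (\<Sum>y\<in>oriented_edges E `` {x}. (\<eta> x - \<eta> y)\<^sup>2 * a (x, y))"
  proof (intro sum.cong refl arg_cong2[where f = "(*)"])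
    fix y assume "y \<in> oriented_edges E `` {x}"
    then have xy: "(x, y) \<in> oriented_edges E" by simp
    then have "cmod (\<sigma> (y, x)) = 1" using edge_sym assms by (auto simp: magnetic_phase_def)
    then show "cmod (schroedinger_matrix \<sigma> q x y) = a (x, y)"
      using xy edge_weight(1)[OF xy] not_edge_self
      by (auto simp: schroedinger_matrix_def norm_mult)
  qed
  finally show ?thesis .
qed

end

theorem theorem1p4:
  fixes V :: "'v set" and E :: "'v set set" and Es :: "('v \<times> 'v) set"
    and w :: "'v \<Rightarrow> real" and a :: "'v \<times> 'v \<Rightarrow> real"
    and \<sigma> :: "'v \<times> 'v \<Rightarrow> complex" and q :: "'v \<Rightarrow> real" and x0 :: 'v
  assumes "simple_graph V E"
    and "infinite V"
    and "locally_finite V E"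
    and "connected_graph V E"
    and "is_orientation E Es"
    and "graph_weights V E w a"
    and "magnetic_phase E \<sigma>"
    and "x0 \<in> V"
    and "(\<lambda>n. real (max_degree V E x0 n) * max_weight_ratio V E Es w a x0 n / (real n)\<^sup>2)
           \<longlonglongrightarrow> 0"
    and "\<exists>C::real. \<forall>u\<in>fin_supp_space V.
           Re (l2_inner V w (magnetic_schroedinger V E w a \<sigma> q u) u) \<ge> - C * (l2_norm V w u)\<^sup>2"
  shows "essentially_self_adjoint V w
           (operator_on (magnetic_schroedinger V E w a \<sigma> q) (fin_supp_space V))"
proof -
  interpret weighted_graph V E Es w a by unfold_locales (fact assms)+
  interpret hermitian_matrix V w "schroedinger_matrix \<sigma> q"
    by (rule hermitian_schroedinger_matrix) (fact assms)
  have H: "magnetic_schroedinger V E w a \<sigma> q u = mat_op u" if "u \<in> fin_supp_space V" for u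
    using that by (intro magnetic_schroedinger_eq_mat_op assms) (simp add: fin_supp_space_def)
  obtain C :: real where C: "\<And>u. u \<in> fin_supp_space V \<Longrightarrow>
      Re (l2_inner V w (mat_op u) u) \<ge> - C * (l2_norm V w u)\<^sup>2"
    using assms(10) by (auto simp: H)
  have "essentially_self_adjoint V w (operator_on mat_op (fin_supp_space V))"
  \<comment> \<open>Radii start at 1, since the cone estimates require a positive radius.\<close>
  proof (rule essentially_self_adjoint_cutoffs[OF C, of "\<lambda>n. cone x0 (Suc n)"])
    show "finite {x. cone x0 (Suc n) x \<noteq> 0}" for n
      by (rule finite_subset[OF cone_support finite_graph_ball[OF assms(8)]]) simp
    show "{x. cone x0 (Suc n) x \<noteq> 0} \<subseteq> V" for n
      by (auto simp: cone_def split: if_splits)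
    show "(\<lambda>n. cone x0 (Suc n) x) \<longlonglongrightarrow> 1" if "x \<in> V" for x
    proof -
      \<comment> \<open>For fixed \<open>x\<close> the distance is constant, so its quotient by the
        radius tends to 0.\<close>
      have "(\<lambda>n. max 0 (1 - real (graph_dist E x0 x) * inverse (real (Suc n))))
          \<longlonglongrightarrow> max 0 (1 - real (graph_dist E x0 x) * 0)"
        by (intro tendsto_intros LIMSEQ_inverse_real_of_nat)
      then show ?thesis using that by (simp add: cone_def divide_inverse)
    qed
    show "(\<lambda>n. real (max_degree V E x0 (Suc n)) * max_weight_ratio V E Es w a x0 (Suc n)
        / (real (Suc n))\<^sup>2) \<longlonglongrightarrow> 0"
      by (rule LIMSEQ_Suc[OF assms(9)])
    show "0 \<le> real (max_degree V E x0 (Suc n)) * max_weight_ratio V E Es w a x0 (Suc n)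
        / (real (Suc n))\<^sup>2" for n
      using max_weight_ratio_pos[OF assms(8), of "Suc n"] by simp
    show "(\<Sum>y | schroedinger_matrix \<sigma> q x y \<noteq> 0.
          (cone x0 (Suc n) x - cone x0 (Suc n) y)\<^sup>2 * cmod (schroedinger_matrix \<sigma> q x y))
        \<le> real (max_degree V E x0 (Suc n)) * max_weight_ratio V E Es w a x0 (Suc n)
          / (real (Suc n))\<^sup>2 * w x" if "x \<in> V" for n x
      unfolding schroedinger_matrix_energy[OF assms(7)]
      by (rule cone_energy[OF assms(8) that]) simp
  qed
  moreover have "operator_on (magnetic_schroedinger V E w a \<sigma> q) (fin_supp_space V)
      = operator_on mat_op (fin_supp_space V)"
    using H by (auto simp: operator_on_def)
  ultimately show ?thesis by simp
qed

end
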